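(* Let $p$ be a prime, let $n\geq 1$ be an integer, and let $b\in\mathbb{F}_p^*$. Let $\zeta_p\in\mathbb{C}$ be a primitive $p$-th root of unity and let $\psi:\mathbb{F}_p\to\mathbb{C}^*$ be the additive character $\psi(x)=\zeta_p^{x}$. Define the inverted $n$-dimensional Kloosterman sum $$I\!K_n(p,b)=\sum_{\substack{x_1\cdots x_{n+1}=b,\ x_i\in\mathbb{F}_p^*\\ x_1+\cdots+x_{n+1}\neq 0}}\psi\!\left(\frac{1}{x_1+\cdots+x_{n+1}}\right)\in\mathbb{Q}(\zeta_p).$$ Then the degree of the algebraic integer $I\!K_n(p,b)$ over $\mathbb{Q}$ equals $$\deg I\!K_n(p,b)=\frac{p-1}{\gcd(n+1,\,p-1)}.$$
   Context: Here $\deg$ of an algebraic number $\alpha$ means the degree $[\mathbb{Q}(\alpha):\mathbb{Q}]$ of its minimal polynomial over $\mathbb{Q}$. Elements of $\mathbb{F}_p$ are identified with integers mod $p$, so $\zeta_p^{x}$ is well defined. *)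

theory Defs
  imports
    "HOL-Number_Theory.Residues"
    "HOL-Algebra.Finite_Extensions"
    "HOL-Algebra.Algebraic_Closure_Type"
begin

abbreviation \<C> :: "complex ring"
  where "\<C> \<equiv> ring_of_type_algebra"

definition alg_degree :: "complex \<Rightarrow> nat"
  where "alg_degree \<alpha> = Polynomials.degree (ring.Irr \<C> \<rat> \<alpha>)"

lemma subfield_Rats_complex: "subfield (\<rat> :: complex set) \<C>"
proof -
  interpret C: field \<C> by (rule field_from_type_algebra)
  have mult: "x \<otimes>\<^bsub>\<C>\<^esub> y = x * y" and add: "x \<oplus>\<^bsub>\<C>\<^esub> y = x + y"
    and zero: "\<zero>\<^bsub>\<C>\<^esub> = 0" and one: "\<one>\<^bsub>\<C>\<^esub> = 1" and carr: "carrier \<C> = UNIV" for x y :: complex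
    by (simp_all add: ring_of_type_algebra_def)
  have neg: "\<ominus>\<^bsub>\<C>\<^esub> x = - x" for x
    by (rule C.minus_equality) (simp_all add: add zero carr)
  have sub: "subring (\<rat> :: complex set) \<C>"
    by (rule C.subringI) (simp_all add: mult add one carr neg)
  show ?thesis
  proof (rule C.subfieldI')
    show "subring (\<rat> :: complex set) \<C>" by (fact sub)
    fix k :: complex assume k: "k \<in> \<rat> - {\<zero>\<^bsub>\<C>\<^esub>}"
    have "inv\<^bsub>\<C>\<^esub> k = inverse k"
      by (rule C.comm_inv_char) (use k in \<open>simp_all add: mult zero one carr\<close>)
    then show "inv\<^bsub>\<C>\<^esub> k \<in> \<rat>" using k by simp
  qed
qed

(* alg_degree \<alpha> is the degree [Q(\<alpha>) : Q] for every \<alpha> algebraic over Q. *)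
lemma alg_degree_eq_dim:
  assumes "(ring.algebraic \<C> over \<rat>) \<alpha>"
  shows "alg_degree \<alpha> = ring.dim \<C> \<rat> (ring.simple_extension \<C> \<rat> \<alpha>)"
proof -
  interpret C: field \<C> by (rule field_from_type_algebra)
  have "\<alpha> \<in> carrier \<C>" by (simp add: ring_of_type_algebra_def)
  then have "C.dimension (alg_degree \<alpha>) \<rat> (C.simple_extension \<rat> \<alpha>)"
    using C.dimension_simple_extension[OF subfield_Rats_complex _ assms]
    unfolding alg_degree_def over_def by blast
  then show ?thesis
    using C.dimI[OF subfield_Rats_complex] by (simp add: over_def)
qed

definition primitive_root_of_unity :: "nat \<Rightarrow> complex \<Rightarrow> bool"
  where "primitive_root_of_unity m z \<longleftrightarrow> m > 0 \<and> z ^ m = 1 \<and> (\<forall>k\<in>{0<..<m}. z ^ k \<noteq> 1)"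

(* The prime field with p elements; its carrier is {0..p - 1}. *)
abbreviation GFp :: "nat \<Rightarrow> int ring"
  where "GFp p \<equiv> residue_ring (int p)"

abbreviation GFp_star :: "nat \<Rightarrow> int set"
  where "GFp_star p \<equiv> carrier (GFp p) - {\<zero>\<^bsub>GFp p\<^esub>}"

(* Elements of GFp p are integers, namely the least nonnegative residues. *)
definition add_char :: "complex \<Rightarrow> int \<Rightarrow> complex"
  where "add_char \<zeta> x = \<zeta> powi x"

definition IK_index :: "nat \<Rightarrow> nat \<Rightarrow> int \<Rightarrow> (nat \<Rightarrow> int) set"
  where "IK_index n p b =
    {x \<in> {1..n+1} \<rightarrow>\<^sub>E GFp_star p.
       (\<Otimes>\<^bsub>GFp p\<^esub>i\<in>{1..n+1}. x i) = b \<and> (\<Oplus>\<^bsub>GFp p\<^esub>i\<in>{1..n+1}. x i) \<noteq> \<zero>\<^bsub>GFp p\<^esub>}"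

definition IK :: "complex \<Rightarrow> nat \<Rightarrow> nat \<Rightarrow> int \<Rightarrow> complex"
  where "IK \<zeta> n p b =
    (\<Sum>x\<in>IK_index n p b. add_char \<zeta> (inv\<^bsub>GFp p\<^esub> (\<Oplus>\<^bsub>GFp p\<^esub>i\<in>{1..n+1}. x i)))"

end

(*
  Write IK(b) = sum over s of N(b, s) zeta^(1/s), where N(b, s) is the number of x with product b
  and sum s. Scaling x by t shows that the conjugate of IK(b) under zeta -> zeta^t is
  IK(b t^-(n+1)). If two such conjugates IK(b), IK(b') agree, the linear independence of
  zeta, ..., zeta^(p-1) gives N(b, s) = N(b', s) for s nonzero, and scaling gives
  N(b, 0) = N(b', 0); hence the ordinary Kloosterman sums Kl(b) and Kl(b') agree. But
  Kl(b) = A + (-1)^n b pi^(n+1) modulo pi^(n+2), where pi = zeta - 1 and A does not depend on b,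
  so b = b'. The number of conjugates is therefore the number of (n+1)-st powers in the
  multiplicative group of the prime field.
*)
theory Submission
  imports Defs "HOL-Number_Theory.Residue_Primitive_Roots"
begin

hide_const (open) Polynomials.degree Polynomials.lead_coeff
hide_const (open) Divisibility.prime Divisibility.irreducible

section \<open>Integer relations between prime roots of unity\<close>

text \<open>No Galois group is set up. The automorphism sending \<open>w\<close> to
  \<open>w ^ t\<close> is replaced by the fact that an integer polynomial vanishing at
  \<open>w\<close> also vanishes at \<open>w ^ t\<close>, which rests on the irreducibility of 1 + X
  + ... + X^(p-1). The number of distinct conjugates is the degree because the product of their
  linear factors has rational coefficients, while every rational annihilator vanishes at all of
  them. The detour through ordinary Kloosterman sums has this reason: the character of a sum splits
  into a product, which gives a recursion in the number of variables, and the character of the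
  reciprocal of a sum does not. The counts N(b, s) are the common data of both kinds of sums. In the
  recursion the linear terms d and b/d multiply to b for each of the p - 1 units d; this produces
  the factor p - 1, that is -1, and one more power of pi. The error terms are under control because
  p is a multiple of pi^2 for odd p; for p = 2 there is only one b.\<close>

definition int_poly_eval :: "int poly \<Rightarrow> complex \<Rightarrow> complex"
  where "int_poly_eval f z = poly (map_poly of_int f) z"

lemma int_poly_eval_0 [simp]: "int_poly_eval 0 z = 0"
  by (simp add: int_poly_eval_def)

lemma int_poly_eval_pCons [simp]: "int_poly_eval (pCons a f) z = of_int a + z * int_poly_eval f z"
  by (cases "a = 0 \<and> f = 0") (auto simp: int_poly_eval_def map_poly_pCons)

lemma int_poly_eval_1 [simp]: "int_poly_eval 1 z = 1"
  by (simp add: one_pCons)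

lemma int_poly_eval_add [simp]: "int_poly_eval (f + g) z = int_poly_eval f z + int_poly_eval g z"
  by (induction f g rule: poly_induct2) (simp_all add: algebra_simps)

lemma int_poly_eval_uminus [simp]: "int_poly_eval (- f) z = - int_poly_eval f z"
  by (induction f) (simp_all add: algebra_simps)

lemma int_poly_eval_diff [simp]: "int_poly_eval (f - g) z = int_poly_eval f z - int_poly_eval g z"
  using int_poly_eval_add[of f "- g" z] by simp

lemma int_poly_eval_smult [simp]: "int_poly_eval (smult a f) z = of_int a * int_poly_eval f z"
  by (induction f) (simp_all add: algebra_simps)

lemma int_poly_eval_mult [simp]: "int_poly_eval (f * g) z = int_poly_eval f z * int_poly_eval g z"
  by (induction f) (simp_all add: algebra_simps)

lemma int_poly_eval_monom [simp]: "int_poly_eval (monom a n) z = of_int a * z ^ n"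
  by (induction n) (simp_all add: monom_0 monom_Suc)

lemma int_poly_eval_pcompose [simp]:
  "int_poly_eval (pcompose f g) z = int_poly_eval f (int_poly_eval g z)"
  by (induction f) (simp_all add: pcompose_pCons algebra_simps)

lemma int_poly_eval_sum [simp]: "int_poly_eval (\<Sum>i\<in>A. f i) z = (\<Sum>i\<in>A. int_poly_eval (f i) z)"
  by (induction A rule: infinite_finite_induct) simp_all

lemma int_poly_eval_prod [simp]: "int_poly_eval (\<Prod>i\<in>A. f i) z = (\<Prod>i\<in>A. int_poly_eval (f i) z)"
  by (induction A rule: infinite_finite_induct) simp_all

lemma int_poly_eval_of_int: "int_poly_eval f (of_int a) = of_int (poly f a)"
  by (induction f) simp_all

lemma int_poly_eval_1_right [simp]: "int_poly_eval f 1 = of_int (poly f 1)"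
  using int_poly_eval_of_int[of f 1] by simp

lemma int_poly_eval_altdef: "int_poly_eval f z = (\<Sum>i\<le>degree f. of_int (coeff f i) * z ^ i)"
proof -
  have "f = (\<Sum>i\<le>degree f. monom (coeff f i) i)"
    by (simp add: poly_as_sum_of_monoms)
  then have "int_poly_eval f z = int_poly_eval (\<Sum>i\<le>degree f. monom (coeff f i) i) z"
    by simp
  then show ?thesis by simp
qed

text \<open>For prime \<open>p\<close>, a \<open>p\<close>-th root of unity other than 1 is already
  primitive. This form is easy to instantiate again, at \<open>w ^ t\<close> and at an arbitrary
  complex root of the cyclotomic polynomial.\<close>

locale prime_root_of_unity =
  fixes p :: nat and w :: complex
  assumes prime_p: "prime p" and w_pow_p: "w ^ p = 1" and w_neq_1: "w \<noteq> 1"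
begin

lemma p_gt_1: "p > 1"
  using prime_p by (rule prime_gt_1_nat)

lemma w_neq_0 [simp]: "w \<noteq> 0"
  using w_pow_p p_gt_1 by (auto simp: power_0_left)

lemma w_pow_eq_1_iff: "w ^ j = 1 \<longleftrightarrow> p dvd j"
proof
  assume *: "w ^ j = 1"
  show "p dvd j"
  proof (rule ccontr)
    assume "\<not> p dvd j"
    then have "coprime j p"
      using prime_p by (metis prime_imp_coprime coprime_commute)
    moreover have "j \<noteq> 0" using \<open>\<not> p dvd j\<close> by (intro notI) simp
    ultimately obtain x y where "j * x = p * y + 1"
      using bezout_nat[of j p] by (auto simp: coprime_iff_gcd_eq_1)
    then have "w ^ (j * x) = w ^ (p * y + 1)" by simp
    then show False
      using * w_neq_1 by (simp add: power_mult power_add w_pow_p)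
  qed
next
  assume "p dvd j"
  then show "w ^ j = 1" by (auto simp: power_mult w_pow_p)
qed

lemma w_power: "\<not> p dvd t \<Longrightarrow> prime_root_of_unity p (w ^ t)"
  using prime_p w_pow_p w_pow_eq_1_iff[of t]
  by unfold_locales (auto simp flip: power_mult simp: mult.commute[of t] power_mult)

lemma sum_powers: "(\<Sum>u<p. (w ^ u) ^ j) = (if p dvd j then of_nat p else 0)"
proof -
  have "(\<Sum>u<p. (w ^ u) ^ j) = (\<Sum>u<p. (w ^ j) ^ u)"
    by (simp flip: power_mult add: mult.commute)
  also have "\<dots> = (if p dvd j then of_nat p else 0)"
  proof (cases "p dvd j")
    case True
    then have "w ^ j = 1" by (simp add: w_pow_eq_1_iff)
    then show ?thesis using True by simp
  next
    case False
    then have "w ^ j \<noteq> 1" by (simp add: w_pow_eq_1_iff)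
    then have "(\<Sum>u<p. (w ^ j) ^ u) = ((w ^ j) ^ p - 1) / (w ^ j - 1)"
      by (rule geometric_sum)
    moreover have "(w ^ j) ^ p = 1"
      by (simp flip: power_mult add: mult.commute[of j] power_mult w_pow_p)
    ultimately show ?thesis using False by simp
  qed
  finally show ?thesis .
qed

text \<open>Summing over all \<open>p\<close>-th roots of unity keeps only the coefficients at
  exponents divisible by \<open>p\<close>. This stands in for the trace of the cyclotomic field: it
  yields the divisibility of \<open>poly f 1\<close> and later the rationality of symmetric
  expressions in the conjugates.\<close>

lemma sum_int_poly_eval:
  obtains m :: int where "(\<Sum>u<p. int_poly_eval f (w ^ u)) = of_nat p * of_int m"
proof
  have "(\<Sum>u<p. int_poly_eval f (w ^ u)) = (\<Sum>i\<le>degree f. of_int (coeff f i) * (\<Sum>u<p. (w ^ u) ^ i))"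
    unfolding int_poly_eval_altdef by (subst sum.swap) (simp add: sum_distrib_left)
  also have "\<dots> = (\<Sum>i\<le>degree f. of_nat p * of_int (if p dvd i then coeff f i else 0))"
    by (rule sum.cong) (simp_all only: sum_powers, simp_all)
  also have "\<dots> = of_nat p * of_int (\<Sum>i\<le>degree f. if p dvd i then coeff f i else 0)"
    by (simp add: sum_distrib_left)
  finally show "(\<Sum>u<p. int_poly_eval f (w ^ u)) =
    of_nat p * of_int (\<Sum>i\<le>degree f. if p dvd i then coeff f i else 0)" .
qed

lemma lessThan_p: "{..<p} = insert 0 {1..<p}"
  using p_gt_1 by auto

lemma not_p_dvd: "u \<in> {1..<p} \<Longrightarrow> \<not> p dvd u"
  by (auto dest: dvd_imp_le)

lemma inverse_mod_p:
  assumes "\<not> p dvd u"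
  obtains t where "t \<in> {1..<p}" "[t * u = 1] (mod p)"
proof -
  have "coprime u p"
    using prime_p assms by (metis prime_imp_coprime coprime_commute)
  then obtain x where x: "[u * x = 1] (mod p)"
    using cong_solve_coprime_nat by auto
  have "[(x mod p) * u = 1] (mod p)"
    using x by (simp add: cong_def mult.commute mod_mult_right_eq)
  moreover from this have "x mod p \<noteq> 0"
    using p_gt_1 by (intro notI) (simp add: cong_def)
  ultimately show ?thesis
    using that[of "x mod p"] p_gt_1 by simp
qed

lemma w_pow_cong: "[i = j] (mod p) \<Longrightarrow> w ^ i = w ^ j"
proof -
  have "w ^ i = w ^ (i mod p)" for i
  proof -
    have "w ^ i = w ^ (p * (i div p) + i mod p)" by simp
    then show ?thesis by (simp only: power_add power_mult w_pow_p) simp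
  qed
  then show "[i = j] (mod p) \<Longrightarrow> w ^ i = w ^ j"
    unfolding cong_def by metis
qed

text \<open>
  The product over \<open>t\<close> of \<open>f(X\<^sup>t)\<close> vanishes at all the \<open>w ^ u\<close> with
  \<open>p\<close> not dividing \<open>u\<close>, so filtering its coefficients by the \<open>p\<close>-th roots of unity leaves
  only its value at 1.
\<close>
lemma p_dvd_poly_1:
  assumes "int_poly_eval f w = 0"
  shows "int p dvd poly f 1"
proof -
  define G where "G = (\<Prod>t\<in>{1..<p}. pcompose f (monom 1 t))"
  have G0: "int_poly_eval G (w ^ u) = 0" if u: "u \<in> {1..<p}" for u
  proof -
    obtain t where t: "t \<in> {1..<p}" "[t * u = 1] (mod p)"
      using inverse_mod_p not_p_dvd[OF u] by metis
    have "(w ^ u) ^ t = w"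
      using w_pow_cong[OF t(2)] by (simp add: mult.commute flip: power_mult)
    then show ?thesis
      using t(1) assms unfolding G_def by (auto intro!: prod_zero bexI[of _ t])
  qed
  obtain m where "(\<Sum>u<p. int_poly_eval G (w ^ u)) = of_nat p * of_int m"
    by (rule sum_int_poly_eval)
  moreover have "(\<Sum>u<p. int_poly_eval G (w ^ u)) = of_int (poly G 1)"
    by (simp add: lessThan_p G0)
  ultimately have "of_int (poly G 1) = (of_int (int p * m) :: complex)"
    by simp
  then have "poly G 1 = int p * m"
    by (simp only: of_int_eq_iff)
  moreover have "poly G 1 = poly f 1 ^ (p - 1)"
    unfolding G_def by (simp add: poly_prod poly_pcompose poly_monom)
  ultimately have "int p dvd poly f 1 ^ (p - 1)"
    by simp
  then show ?thesis
    using prime_p by (meson prime_dvd_power prime_nat_int_transfer)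
qed

end

section \<open>Irreducibility of the cyclotomic polynomial of prime index\<close>

definition cyclotomic_prime :: "nat \<Rightarrow> int poly"
  where "cyclotomic_prime p = (\<Sum>i<p. monom 1 i)"

lemma coeff_cyclotomic_prime: "coeff (cyclotomic_prime p) i = (if i < p then 1 else 0)"
  by (auto simp: cyclotomic_prime_def coeff_sum)

lemma degree_cyclotomic_prime: "p > 0 \<Longrightarrow> degree (cyclotomic_prime p) = p - 1"
  by (intro antisym degree_le le_degree) (auto simp: coeff_cyclotomic_prime)

lemma poly_cyclotomic_prime_1: "poly (cyclotomic_prime p) 1 = int p"
  by (simp add: cyclotomic_prime_def poly_sum poly_monom)

lemma cyclotomic_prime_root:
  assumes "prime p" "int_poly_eval (cyclotomic_prime p) z = 0"
  shows "prime_root_of_unity p z"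
proof
  have sum0: "(\<Sum>i<p. z ^ i) = 0"
    using assms(2) by (simp add: cyclotomic_prime_def)
  show "z \<noteq> 1"
    using sum0 assms(1) by (intro notI) simp
  then show "z ^ p = 1"
    using sum0 geometric_sum[of z p] by simp
qed (fact assms(1))

text \<open>A nonconstant divisor has a complex root, which is also a root of 1 + X + ... + X^(p-1)
  and hence a \<open>p\<close>-th root of unity other than 1; \<open>p_dvd_poly_1\<close> applies at
  that root.\<close>

lemma p_dvd_poly_1_of_dvd_cyclotomic:
  assumes "prime p" "f dvd cyclotomic_prime p" "degree f > 0"
  shows "int p dvd poly f 1"
proof -
  have "degree (map_poly of_int f :: complex poly) > 0"
    using assms(3) by (simp add: degree_map_poly)
  then have "\<not> constant (poly (map_poly of_int f :: complex poly))"
    by (simp add: constant_degree)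
  then obtain z where z: "int_poly_eval f z = 0"
    using fundamental_theorem_of_algebra unfolding int_poly_eval_def by blast
  then have "int_poly_eval (cyclotomic_prime p) z = 0"
    using assms(2) by (auto elim!: dvdE)
  then interpret prime_root_of_unity p z
    by (rule cyclotomic_prime_root[OF assms(1)])
  show ?thesis
    using z by (rule p_dvd_poly_1)
qed

text \<open>The value at 1 is \<open>p\<close>, while each nonconstant factor takes a value
  divisible by \<open>p\<close> there, so two such factors would make p^2 divide \<open>p\<close>.
  Since the polynomial is monic, a constant factor is a unit.\<close>

lemma irreducible_cyclotomic_prime:
  assumes "prime p"
  shows "irreducible (cyclotomic_prime p)"
proof (rule Factorial_Ring.irreducibleI)
  have p: "p > 1" using assms by (rule prime_gt_1_nat)
  have deg: "degree (cyclotomic_prime p) = p - 1"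
    using p by (simp add: degree_cyclotomic_prime)
  show nz: "cyclotomic_prime p \<noteq> 0"
    using deg p by (intro notI) simp
  show "\<not> is_unit (cyclotomic_prime p)"
    using deg p by (auto simp: is_unit_poly_iff)
  fix f g assume fg: "cyclotomic_prime p = f * g"
  have lc: "lead_coeff f * lead_coeff g = 1"
    using deg p unfolding lead_coeff_mult[symmetric] fg[symmetric] by (simp add: coeff_cyclotomic_prime)
  have unit: "is_unit h" if "degree h = 0" "is_unit (lead_coeff h)" for h :: "int poly"
    using that by (auto simp: is_unit_poly_iff elim!: degree_eq_zeroE)
  show "is_unit f \<or> is_unit g"
  proof (rule ccontr)
    assume "\<not> (is_unit f \<or> is_unit g)"
    moreover have "is_unit (lead_coeff f)" "is_unit (lead_coeff g)"
      using lc dvdI[of 1 "lead_coeff f" "lead_coeff g"] dvdI[of 1 "lead_coeff g" "lead_coeff f"]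
      by (simp_all add: mult.commute)
    ultimately have "degree f > 0" "degree g > 0"
      using unit by blast+
    then have "int p dvd poly f 1" "int p dvd poly g 1"
      using p_dvd_poly_1_of_dvd_cyclotomic[OF assms] fg by auto
    then have "int p * int p dvd poly f 1 * poly g 1"
      by (rule mult_dvd_mono)
    moreover have "poly f 1 * poly g 1 = int p"
      using poly_cyclotomic_prime_1[of p] fg by simp
    ultimately have "int p * int p dvd int p * 1"
      by simp
    then show False
      using p by (subst (asm) dvd_times_left_cancel_iff) auto
  qed
qed

section \<open>Conjugation and linear independence over the integers\<close>

context prime_root_of_unity
begin

lemma sum_w_powers: "(\<Sum>i<p. w ^ i) = 0"
  using w_neq_1 by (simp add: geometric_sum w_pow_p)

lemma cyclotomic_eval_w: "int_poly_eval (cyclotomic_prime p) w = 0"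
  by (simp add: cyclotomic_prime_def sum_w_powers)

text \<open>Irreducible elements of Z[X] are prime. A nonzero annihilator \<open>g\<close> of least
  degree divides every annihilator up to a constant. Applied to the cyclotomic polynomial this gives
  a product \<open>g * q\<close> in which \<open>q\<close> has too small a degree to be divisible by
  it, so it divides \<open>g\<close> and thereby every annihilator.\<close>

lemma cyclotomic_dvd:
  assumes "int_poly_eval f w = 0"
  shows "cyclotomic_prime p dvd f"
proof -
  define P where "P g \<longleftrightarrow> g \<noteq> 0 \<and> int_poly_eval g w = 0" for g
  have irred: "irreducible (cyclotomic_prime p)"
    using prime_p by (rule irreducible_cyclotomic_prime)
  then have prime: "prime_elem (cyclotomic_prime p)"
    by (simp add: prime_elem_iff_irreducible)
  have deg: "degree (cyclotomic_prime p) = p - 1"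
    using p_gt_1 by (simp add: degree_cyclotomic_prime)
  have "P (cyclotomic_prime p)"
    using irred by (auto simp: P_def cyclotomic_eval_w)
  then obtain g where g: "P g" and min: "\<And>h. P h \<Longrightarrow> degree g \<le> degree h"
    using ex_has_least_nat[of P _ degree] by metis
  have g0: "degree g > 0"
  proof (rule ccontr)
    assume "\<not> degree g > 0"
    then obtain a where "g = [:a:]" by (auto elim: degree_eq_zeroE)
    then show False using g by (simp add: P_def)
  qed
  \<comment> \<open>Over Z only pseudo-division is available, which costs the constant
    \<open>a\<close>; the remainder is an annihilator of smaller degree than \<open>g\<close>, hence
    0.\<close>
  have quot: "\<exists>a q. a \<noteq> 0 \<and> smult a h = g * q" if h: "int_poly_eval h w = 0" for h
  proof -
    have "g \<noteq> 0" using g by (simp add: P_def)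
    from pseudo_mod[OF this, of h] obtain a q where aq: "a \<noteq> 0" "smult a h = g * q + pseudo_mod h g"
      and r: "pseudo_mod h g = 0 \<or> degree (pseudo_mod h g) < degree g" by blast
    have "int_poly_eval (smult a h) w = int_poly_eval (g * q + pseudo_mod h g) w"
      using aq by simp
    then have "int_poly_eval (pseudo_mod h g) w = 0"
      using g h by (simp add: P_def)
    then have "pseudo_mod h g = 0"
      using r min[of "pseudo_mod h g"] by (metis P_def not_less)
    then show ?thesis using aq by auto
  qed
  obtain a q where aq: "a \<noteq> 0" "smult a (cyclotomic_prime p) = g * q"
    using quot[OF cyclotomic_eval_w] by blast
  have "g \<noteq> 0" "q \<noteq> 0"
    using aq irred g by (auto simp: P_def)
  then have dgq: "degree g + degree q = p - 1"
    using aq deg by (metis degree_mult_eq degree_smult_eq)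
  have "cyclotomic_prime p dvd g * q"
    unfolding aq(2)[symmetric] by (rule dvd_smult) simp
  then have "cyclotomic_prime p dvd g \<or> cyclotomic_prime p dvd q"
    using prime by (simp add: prime_elem_dvd_mult_iff)
  moreover have "\<not> cyclotomic_prime p dvd q"
    using dvd_imp_degree_le[of "cyclotomic_prime p" q] \<open>q \<noteq> 0\<close> deg dgq g0 by auto
  ultimately have dvd_g: "cyclotomic_prime p dvd g" by simp
  obtain c r where cr: "c \<noteq> 0" "smult c f = g * r"
    using quot[OF assms] by blast
  have "cyclotomic_prime p dvd [:c:] * f"
    using dvd_g cr(2) by simp
  moreover have "\<not> cyclotomic_prime p dvd [:c:]"
    using dvd_imp_degree_le[of "cyclotomic_prime p" "[:c:]"] cr(1) deg p_gt_1 by auto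
  ultimately show ?thesis
    using prime by (metis prime_elem_dvd_mult_iff)
qed

text \<open>The cyclotomic polynomial divides \<open>f\<close>, and \<open>w ^ t\<close> is another
  of its roots.\<close>

lemma int_poly_eval_conjugate:
  assumes "int_poly_eval f w = 0" "\<not> p dvd t"
  shows "int_poly_eval f (w ^ t) = 0"
proof -
  interpret wt: prime_root_of_unity p "w ^ t"
    using assms(2) by (rule w_power)
  show ?thesis
    using cyclotomic_dvd[OF assms(1)] wt.cyclotomic_eval_w by (auto elim!: dvdE)
qed

text \<open>Cancelling one factor \<open>w\<close> moves the exponents to 0, ..., p - 2, so the
  resulting polynomial has smaller degree than the cyclotomic polynomial that divides it. Exponent 0
  must be left out, as all \<open>p\<close> powers together add up to 0.\<close>

lemma w_powers_independent:
  fixes c :: "nat \<Rightarrow> int"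
  assumes "(\<Sum>j\<in>{1..<p}. of_int (c j) * w ^ j) = 0" "j \<in> {1..<p}"
  shows "c j = 0"
proof -
  define f where "f = (\<Sum>j\<in>{1..<p}. monom (c j) (j - 1))"
  have "w * int_poly_eval f w = (\<Sum>j\<in>{1..<p}. of_int (c j) * w ^ j)"
    unfolding f_def int_poly_eval_sum sum_distrib_left
    by (intro sum.cong) (auto simp flip: power_Suc)
  then have "int_poly_eval f w = 0"
    using assms(1) by simp
  then have dvd: "cyclotomic_prime p dvd f"
    by (rule cyclotomic_dvd)
  have "degree f \<le> p - 2"
    unfolding f_def by (intro degree_sum_le) (auto intro!: order.trans[OF degree_monom_le])
  then have "f = 0"
    using dvd_imp_degree_le[OF dvd] p_gt_1 by (intro ccontr[of "f = 0"]) (simp add: degree_cyclotomic_prime)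
  moreover have "coeff f (j - 1) = c j"
  proof -
    have "coeff f (j - 1) = (\<Sum>i\<in>{1..<p}. if i = j then c i else 0)"
      unfolding f_def coeff_sum using assms(2) by (intro sum.cong) auto
    then show ?thesis using assms(2) by simp
  qed
  ultimately show ?thesis by simp
qed

end

section \<open>The uniformizer in the ring of integers and the prime field\<close>

context prime_root_of_unity
begin

text \<open>This is Z[w]. Congruences modulo powers of \<open>w - 1\<close> are stated with an
  explicit cofactor from this set instead of ideals.\<close>

definition int_ring_adjoin :: "complex set"
  where "int_ring_adjoin = range (\<lambda>f. int_poly_eval f w)"

lemma int_ring_adjoinE:
  assumes "x \<in> int_ring_adjoin"
  obtains f where "x = int_poly_eval f w"
  using assms by (auto simp: int_ring_adjoin_def)

lemma int_poly_eval_in_adjoin [intro!]: "int_poly_eval f w \<in> int_ring_adjoin"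
  by (simp add: int_ring_adjoin_def)

lemma adjoin_add [intro]: "x \<in> int_ring_adjoin \<Longrightarrow> y \<in> int_ring_adjoin \<Longrightarrow> x + y \<in> int_ring_adjoin"
  by (auto elim!: int_ring_adjoinE simp flip: int_poly_eval_add)

lemma adjoin_diff [intro]: "x \<in> int_ring_adjoin \<Longrightarrow> y \<in> int_ring_adjoin \<Longrightarrow> x - y \<in> int_ring_adjoin"
  by (auto elim!: int_ring_adjoinE simp flip: int_poly_eval_diff)

lemma adjoin_uminus [intro]: "x \<in> int_ring_adjoin \<Longrightarrow> - x \<in> int_ring_adjoin"
  by (auto elim!: int_ring_adjoinE simp flip: int_poly_eval_uminus)

lemma adjoin_mult [intro]: "x \<in> int_ring_adjoin \<Longrightarrow> y \<in> int_ring_adjoin \<Longrightarrow> x * y \<in> int_ring_adjoin"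
  by (auto elim!: int_ring_adjoinE simp flip: int_poly_eval_mult)

lemma adjoin_of_int [simp, intro]: "of_int a \<in> int_ring_adjoin"
  using int_poly_eval_in_adjoin[of "[:a:]"] by simp

lemma adjoin_of_nat [simp, intro]: "of_nat a \<in> int_ring_adjoin"
  using adjoin_of_int[of "int a"] by simp

lemma adjoin_0 [simp, intro]: "0 \<in> int_ring_adjoin"
  using adjoin_of_int[of 0] by simp

lemma adjoin_1 [simp, intro]: "1 \<in> int_ring_adjoin"
  using adjoin_of_int[of 1] by simp

lemma adjoin_w [simp, intro]: "w \<in> int_ring_adjoin"
  using int_poly_eval_in_adjoin[of "[:0, 1:]"] by simp

lemma adjoin_power [intro]: "x \<in> int_ring_adjoin \<Longrightarrow> x ^ k \<in> int_ring_adjoin"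
  by (induction k) auto

lemma adjoin_sum [intro]: "(\<And>i. i \<in> A \<Longrightarrow> f i \<in> int_ring_adjoin) \<Longrightarrow> sum f A \<in> int_ring_adjoin"
  by (induction A rule: infinite_finite_induct) auto

text \<open>The ideal generated by \<open>w - 1\<close> meets Z only inside pZ: if \<open>r\<close>
  is the value of \<open>f\<close> at \<open>w\<close>, then a - (X - 1) f vanishes at
  \<open>w\<close> and has value \<open>a\<close> at 1.\<close>

lemma p_dvd_if_multiple_of_uniformizer:
  assumes "of_int a = (w - 1) * r" "r \<in> int_ring_adjoin"
  shows "int p dvd a"
proof -
  obtain f where f: "r = int_poly_eval f w"
    using assms(2) by (rule int_ring_adjoinE)
  have "int_poly_eval ([:a:] - [:-1, 1:] * f) w = 0"
    using assms(1) f by (simp add: algebra_simps)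
  then have "int p dvd poly ([:a:] - [:-1, 1:] * f) 1"
    by (rule p_dvd_poly_1)
  then show ?thesis by simp
qed

lemma w_power_expansion:
  "\<exists>r\<in>int_ring_adjoin. w ^ j = 1 + of_nat j * (w - 1) + (w - 1)\<^sup>2 * r"
proof (induction j)
  case 0
  show ?case by (intro bexI[of _ 0]) auto
next
  case (Suc j)
  then obtain r where r: "r \<in> int_ring_adjoin" "w ^ j = 1 + of_nat j * (w - 1) + (w - 1)\<^sup>2 * r"
    by blast
  show ?case
  proof (rule bexI)
    show "w ^ Suc j = 1 + of_nat (Suc j) * (w - 1) + (w - 1)\<^sup>2 * (of_nat j + r * w)"
      unfolding power_Suc r(2) by (simp add: algebra_simps power2_eq_square)
    show "of_nat j + r * w \<in> int_ring_adjoin"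
      using r(1) by auto
  qed
qed

text \<open>Expanding each term of 1 + w + ... + w^(p-1) = 0 gives p = - p m (w - 1) modulo (w -
  1)^2 with m = (p - 1) / 2, an integer for odd \<open>p\<close>. For p = 2 the claim is false,
  because then w - 1 = -2.\<close>

lemma p_multiple_of_uniformizer_square:
  assumes "odd p"
  shows "\<exists>c\<in>int_ring_adjoin. of_nat p = (w - 1)\<^sup>2 * c"
proof -
  obtain m where m: "p = 2 * m + 1" using assms by (rule oddE)
  obtain r where r: "\<And>j. r j \<in> int_ring_adjoin"
    "\<And>j. w ^ j = 1 + of_nat j * (w - 1) + (w - 1)\<^sup>2 * r j"
    using w_power_expansion by metis
  have "(\<Sum>j<p. of_nat j :: complex) = of_nat (\<Sum>j<p. j)"
    by simp
  also have "(\<Sum>j<p. j) = p * m"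
  proof -
    have "2 * (\<Sum>j<q. j) = q * (q - 1)" for q :: nat
    proof (induction q)
      case (Suc q)
      then show ?case by (cases q) (simp_all add: algebra_simps)
    qed simp
    from this[of p] show ?thesis using m by simp
  qed
  finally have gauss: "(\<Sum>j<p. of_nat j :: complex) = of_nat p * of_nat m"
    by simp
  have "0 = (\<Sum>j<p. 1 + of_nat j * (w - 1) + (w - 1)\<^sup>2 * r j)"
    using sum_w_powers r(2) by simp
  also have "\<dots> = of_nat p + of_nat p * of_nat m * (w - 1) + (w - 1)\<^sup>2 * (\<Sum>j<p. r j)"
    by (simp add: sum.distrib sum_distrib_left[symmetric] sum_distrib_right[symmetric] gauss)
  finally have *: "of_nat p = - of_nat p * of_nat m * (w - 1) - (w - 1)\<^sup>2 * (\<Sum>j<p. r j)"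
    by (simp add: algebra_simps add_eq_0_iff)
  \<comment> \<open>The relation just obtained first shows \<open>p\<close> to be a multiple of
    \<open>w - 1\<close>, with cofactor \<open>s\<close>; putting this back into its right-hand side
    yields the second factor.\<close>
  define s where "s = - of_nat p * of_nat m - (w - 1) * (\<Sum>j<p. r j)"
  have s: "of_nat p = (w - 1) * s"
    by (subst *) (simp add: s_def algebra_simps power2_eq_square)
  have "of_nat p = - ((w - 1) * s) * of_nat m * (w - 1) - (w - 1)\<^sup>2 * (\<Sum>j<p. r j)"
    unfolding s[symmetric] by (rule *)
  then have s2: "of_nat p = (w - 1)\<^sup>2 * (- of_nat m * s - (\<Sum>j<p. r j))"
    by (simp add: algebra_simps power2_eq_square)
  show ?thesis
  proof
    show "of_nat p = (w - 1)\<^sup>2 * (- of_nat m * s - (\<Sum>j<p. r j))"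
      by (rule s2)
    show "- of_nat m * s - (\<Sum>j<p. r j) \<in> int_ring_adjoin"
      unfolding s_def using r(1) by (auto intro!: adjoin_diff adjoin_mult adjoin_uminus adjoin_sum)
  qed
qed

text \<open>Unlike \<^const>\<open>add_char\<close>, this is periodic, so arguments need not be reduced modulo \<open>p\<close>.\<close>
definition chi :: "int \<Rightarrow> complex"
  where "chi m = w ^ nat (m mod int p)"

lemma chi_cong: "[a = b] (mod int p) \<Longrightarrow> chi a = chi b"
  by (simp add: chi_def cong_def)

lemma chi_mod [simp]: "chi (a mod int p) = chi a"
  by (rule chi_cong) simp

lemma chi_of_nat: "chi (int j) = w ^ j"
  unfolding chi_def by (intro w_pow_cong) (simp add: cong_def nat_mod_distrib)

lemma chi_0 [simp]: "chi 0 = 1"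
  using chi_of_nat[of 0] by simp

lemma chi_add: "chi (a + b) = chi a * chi b"
proof -
  have "chi (a + b) = chi (int (nat (a mod int p) + nat (b mod int p)))"
    using p_gt_1 by (intro chi_cong) (simp add: cong_def mod_simps)
  then show ?thesis
    unfolding chi_of_nat by (simp add: power_add chi_def)
qed

lemma adjoin_chi [simp, intro]: "chi a \<in> int_ring_adjoin"
  by (auto simp: chi_def)

text \<open>\<open>w_power_expansion\<close> has the residue of \<open>a\<close> as linear
  coefficient. Trading it for \<open>a\<close> changes it by a multiple of \<open>p\<close>, hence
  of (w - 1)^2, and this disappears into the remainder.\<close>

lemma chi_expansion:
  assumes "odd p"
  shows "\<exists>r\<in>int_ring_adjoin. chi a = 1 + of_int a * (w - 1) + (w - 1)\<^sup>2 * r"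
proof -
  define j where "j = nat (a mod int p)"
  have a: "a = int j + int p * (a div int p)"
    using p_gt_1 by (simp add: j_def)
  obtain c where c: "c \<in> int_ring_adjoin" "of_nat p = (w - 1)\<^sup>2 * c"
    using p_multiple_of_uniformizer_square[OF assms] by blast
  obtain r where r: "r \<in> int_ring_adjoin" "w ^ j = 1 + of_nat j * (w - 1) + (w - 1)\<^sup>2 * r"
    using w_power_expansion by blast
  have ac: "(of_int a :: complex) = of_nat j + (w - 1)\<^sup>2 * c * of_int (a div int p)"
    unfolding c(2)[symmetric] by (subst a) simp
  show ?thesis
  proof
    show "chi a = 1 + of_int a * (w - 1) + (w - 1)\<^sup>2 * (r - c * of_int (a div int p) * (w - 1))"
      unfolding ac using r(2) by (simp add: chi_def j_def algebra_simps)
    show "r - c * of_int (a div int p) * (w - 1) \<in> int_ring_adjoin"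
      using r(1) c(1) by auto
  qed
qed

section \<open>Units modulo p as integers, inverted by the power p - 2\<close>

abbreviation units_p :: "int set"
  where "units_p \<equiv> {1..int p - 1}"

lemma units_p_not_dvd: "d \<in> units_p \<Longrightarrow> \<not> int p dvd d"
  by (auto dest: zdvd_imp_le)

lemma mod_in_units_p: "\<not> int p dvd a \<Longrightarrow> a mod int p \<in> units_p"
  using p_gt_1 pos_mod_bound[of "int p" a] pos_mod_sign[of "int p" a]
  by (auto simp: dvd_eq_mod_eq_0 simp del: pos_mod_bound pos_mod_sign)

lemma prime_int_p: "prime (int p)"
  using prime_p by simp

lemma not_dvd_mult: "\<not> int p dvd a \<Longrightarrow> \<not> int p dvd b \<Longrightarrow> \<not> int p dvd a * b"
  using prime_int_p by (simp add: prime_dvd_mult_iff)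

lemma not_dvd_power: "\<not> int p dvd a \<Longrightarrow> \<not> int p dvd a ^ k"
  using prime_int_p prime_dvd_power by blast

lemma fermat_int: "\<not> int p dvd a \<Longrightarrow> [a ^ (p - 1) = 1] (mod int p)"
proof -
  assume "\<not> int p dvd a"
  interpret residues "int p" "residue_ring (int p)"
    using p_gt_1 by unfold_locales auto
  have "coprime a (int p)"
    using prime_int_p \<open>\<not> int p dvd a\<close> by (metis prime_imp_coprime coprime_commute)
  then show ?thesis
    using euler_theorem[of a] prime_p by (simp add: totient_prime)
qed

text \<open>By Fermat the power \<open>p - 2\<close> is a reciprocal modulo \<open>p\<close>, so
  inverses stay inside the integers. For p = 2 the exponent is 0 and the unit is congruent to
  1.\<close>

lemma inverse_cong: "\<not> int p dvd a \<Longrightarrow> [a * a ^ (p - 2) = 1] (mod int p)"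
proof -
  have "a * a ^ (p - 2) = a ^ (p - 1)"
    using p_gt_1 by (simp flip: power_Suc add: Suc_diff_Suc numeral_2_eq_2)
  then show "\<not> int p dvd a \<Longrightarrow> ?thesis" using fermat_int by simp
qed

lemma mult_cancel_cong:
  "\<not> int p dvd a \<Longrightarrow> [a * x = a * y] (mod int p) \<longleftrightarrow> [x = y] (mod int p)"
  using prime_int_p by (intro cong_mult_lcancel) (metis prime_imp_coprime coprime_commute)

lemma units_p_cong_eq: "x \<in> units_p \<Longrightarrow> y \<in> units_p \<Longrightarrow> [x = y] (mod int p) \<Longrightarrow> x = y"
  by (auto simp: cong_def)

lemma mult_eq_iff_cong:
  assumes "\<not> int p dvd P"
  shows "[c * P = b] (mod int p) \<longleftrightarrow> [c = b * P ^ (p - 2)] (mod int p)"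
proof -
  have "[P * (b * P ^ (p - 2)) = b * 1] (mod int p)"
    using cong_mult[OF cong_refl[of b] inverse_cong[OF assms]] by (simp add: ac_simps)
  then have "[c * P = b] (mod int p) \<longleftrightarrow> [P * c = P * (b * P ^ (p - 2))] (mod int p)"
    by (simp add: mult.commute) (meson cong_sym cong_trans)
  then show ?thesis
    using mult_cancel_cong[OF assms] by simp
qed

lemma bij_betw_mult:
  assumes "\<not> int p dvd a"
  shows "bij_betw (\<lambda>d. a * d mod int p) units_p units_p"
proof -
  have "inj_on (\<lambda>d. a * d mod int p) units_p"
  proof (rule inj_onI)
    fix x y assume "x \<in> units_p" "y \<in> units_p" "a * x mod int p = a * y mod int p"
    then show "x = y"
      using mult_cancel_cong[OF assms] units_p_cong_eq by (simp add: cong_def)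
  qed
  moreover have "(\<lambda>d. a * d mod int p) ` units_p \<subseteq> units_p"
    by (intro image_subsetI mod_in_units_p not_dvd_mult assms) (rule units_p_not_dvd)
  ultimately show ?thesis
    by (simp add: bij_betw_def endo_inj_surj)
qed

lemma bij_betw_inverse:
  "bij_betw (\<lambda>d. d ^ (p - 2) mod int p) units_p units_p"
proof -
  have "inj_on (\<lambda>d. d ^ (p - 2) mod int p) units_p"
  proof (rule inj_onI)
    fix x y assume xy: "x \<in> units_p" "y \<in> units_p" "x ^ (p - 2) mod int p = y ^ (p - 2) mod int p"
    have "[x * y ^ (p - 2) = x * x ^ (p - 2)] (mod int p)"
      using xy(3) by (intro cong_mult) (auto simp: cong_def)
    then have "[x * y ^ (p - 2) = 1] (mod int p)"
      using inverse_cong[OF units_p_not_dvd[OF xy(1)]] cong_trans by blast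
    then have "[1 * y = x] (mod int p)"
      using mult_eq_iff_cong[OF units_p_not_dvd[OF xy(2)], of 1 x]
      by (subst mult_eq_iff_cong[OF units_p_not_dvd[OF xy(2)]]) (metis cong_sym)
    then show "x = y"
      using units_p_cong_eq[OF xy(1,2)] cong_sym by auto
  qed
  moreover have "(\<lambda>d. d ^ (p - 2) mod int p) ` units_p \<subseteq> units_p"
    by (intro image_subsetI mod_in_units_p not_dvd_power units_p_not_dvd)
  ultimately show ?thesis
    by (simp add: bij_betw_def endo_inj_surj)
qed

end

section \<open>Distinctness of Kloosterman sums\<close>

context prime_root_of_unity
begin

text \<open>Here \<open>k\<close> is the number of variables, n + 1 in the theorem. Only the residue
  class of \<open>b\<close> matters, so unreduced products may stand for it.\<close>

definition kl_index :: "nat \<Rightarrow> int \<Rightarrow> (nat \<Rightarrow> int) set"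
  where "kl_index k b = {x \<in> {1..k} \<rightarrow>\<^sub>E units_p. [(\<Prod>i\<in>{1..k}. x i) = b] (mod int p)}"

definition kloosterman :: "nat \<Rightarrow> int \<Rightarrow> complex"
  where "kloosterman k b = (\<Sum>x\<in>kl_index k b. chi (\<Sum>i\<in>{1..k}. x i))"

lemma finite_PiE_units: "finite ({1..k::nat} \<rightarrow>\<^sub>E units_p)"
  by (intro finite_PiE) auto

lemma finite_kl_index [simp, intro]: "finite (kl_index k b)"
  unfolding kl_index_def using finite_PiE_units by simp

lemma prod_units_not_dvd: "x \<in> {1..k::nat} \<rightarrow>\<^sub>E units_p \<Longrightarrow> \<not> int p dvd (\<Prod>i\<in>{1..k}. x i)"
  using units_p_not_dvd by (subst prime_dvd_prod_iff[OF _ prime_int_p]) (auto simp: PiE_iff)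

lemma kloosterman_cong: "[a = b] (mod int p) \<Longrightarrow> kloosterman k a = kloosterman k b"
proof -
  assume "[a = b] (mod int p)"
  then have "kl_index k a = kl_index k b"
    by (simp add: kl_index_def cong_def)
  then show ?thesis by (simp add: kloosterman_def)
qed

lemma kloosterman_altdef:
  "kloosterman k b = (\<Sum>x\<in>{1..k} \<rightarrow>\<^sub>E units_p.
     if [(\<Prod>i\<in>{1..k}. x i) = b] (mod int p) then chi (\<Sum>i\<in>{1..k}. x i) else 0)"
  unfolding kloosterman_def kl_index_def
  by (rule sum.inter_filter[OF finite_PiE_units])

lemma sum_units_delta:
  fixes f :: "int \<Rightarrow> complex"
  assumes "\<not> int p dvd a" "\<And>x y. [x = y] (mod int p) \<Longrightarrow> f x = f y"
  shows "(\<Sum>d\<in>units_p. if [d = a] (mod int p) then f d else 0) = f a"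
proof -
  have "(\<Sum>d\<in>units_p. if [d = a] (mod int p) then f d else 0) =
        (\<Sum>d\<in>units_p. if d = a mod int p then f d else 0)"
    by (rule sum.cong) (auto simp: cong_def)
  also have "\<dots> = f (a mod int p)"
    using mod_in_units_p[OF assms(1)] by simp
  also have "\<dots> = f a"
    by (rule assms(2)) simp
  finally show ?thesis .
qed

lemma sum_PiE_Suc:
  fixes f :: "(nat \<Rightarrow> int) \<Rightarrow> complex"
  shows "(\<Sum>x\<in>{1..Suc k} \<rightarrow>\<^sub>E T. f x) = (\<Sum>c\<in>T. \<Sum>g\<in>{1..k} \<rightarrow>\<^sub>E T. f (g(Suc k := c)))"
proof -
  have "{1..Suc k} = insert (Suc k) {1..k}" by auto
  then have "{1..Suc k} \<rightarrow>\<^sub>E T = (\<lambda>(c, g). g(Suc k := c)) ` (T \<times> ({1..k} \<rightarrow>\<^sub>E T))"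
    by (simp add: PiE_insert_eq)
  moreover have "inj_on (\<lambda>(c, g). g(Suc k := c)) (T \<times> ({1..k} \<rightarrow>\<^sub>E T))"
    by (rule inj_combinator) simp
  ultimately have "(\<Sum>x\<in>{1..Suc k} \<rightarrow>\<^sub>E T. f x) = (\<Sum>(c, g)\<in>T \<times> ({1..k} \<rightarrow>\<^sub>E T). f (g(Suc k := c)))"
    by (simp add: sum.reindex case_prod_unfold)
  then show ?thesis by (simp add: sum.cartesian_product)
qed

text \<open>Once the product \<open>d\<close> of the first \<open>k\<close> variables is fixed, the
  last variable must be b/d. The sum in one more variable is thus a multiplicative convolution with
  the character.\<close>

lemma kloosterman_Suc:
  assumes "\<not> int p dvd b"
  shows "kloosterman (Suc k) b = (\<Sum>d\<in>units_p. chi (b * d ^ (p - 2)) * kloosterman k d)"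
proof -
  let ?X = "{1..k} \<rightarrow>\<^sub>E units_p"
  let ?P = "\<lambda>g. \<Prod>i\<in>{1..k}. (g i :: int)"
  let ?S = "\<lambda>g. \<Sum>i\<in>{1..k}. (g i :: int)"
  have upd: "(\<Prod>i\<in>{1..Suc k}. (g(Suc k := c)) i) = c * ?P g"
            "(\<Sum>i\<in>{1..Suc k}. (g(Suc k := c)) i) = c + ?S g" for g and c :: int
    by (simp_all add: mult.commute)
  have "kloosterman (Suc k) b =
    (\<Sum>c\<in>units_p. \<Sum>g\<in>?X. if [c * ?P g = b] (mod int p) then chi (c + ?S g) else 0)"
    unfolding kloosterman_altdef sum_PiE_Suc upd ..
  also have "\<dots> = (\<Sum>g\<in>?X. \<Sum>c\<in>units_p. if [c * ?P g = b] (mod int p) then chi (c + ?S g) else 0)"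
    by (rule sum.swap)
  also have "\<dots> = (\<Sum>g\<in>?X. chi (b * ?P g ^ (p - 2)) * chi (?S g))"
  proof (rule sum.cong)
    fix g assume g: "g \<in> ?X"
    have nd: "\<not> int p dvd b * ?P g ^ (p - 2)"
      by (intro not_dvd_mult assms not_dvd_power prod_units_not_dvd g)
    have "(\<Sum>c\<in>units_p. if [c * ?P g = b] (mod int p) then chi (c + ?S g) else 0) =
      (\<Sum>c\<in>units_p. if [c = b * ?P g ^ (p - 2)] (mod int p) then chi (c + ?S g) else 0)"
      by (simp only: mult_eq_iff_cong[OF prod_units_not_dvd[OF g]])
    also have "\<dots> = chi (b * ?P g ^ (p - 2) + ?S g)"
      by (rule sum_units_delta[OF nd]) (intro chi_cong cong_add cong_refl)
    finally show "(\<Sum>c\<in>units_p. if [c * ?P g = b] (mod int p) then chi (c + ?S g) else 0) =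
      chi (b * ?P g ^ (p - 2)) * chi (?S g)"
      by (simp add: chi_add)
  qed simp
  \<comment> \<open>\<open>sum_units_delta\<close> read backwards: it introduces the product as a
    new summation variable \<open>d\<close>.\<close>
  also have "\<dots> = (\<Sum>g\<in>?X. \<Sum>d\<in>units_p. if [d = ?P g] (mod int p)
    then chi (b * d ^ (p - 2)) * chi (?S g) else 0)"
    by (intro sum.cong refl sum_units_delta[symmetric] prod_units_not_dvd)
       (simp_all add: chi_cong cong_mult cong_pow)
  also have "\<dots> = (\<Sum>d\<in>units_p. \<Sum>g\<in>?X. if [d = ?P g] (mod int p)
    then chi (b * d ^ (p - 2)) * chi (?S g) else 0)"
    by (rule sum.swap)
  also have "\<dots> = (\<Sum>d\<in>units_p. chi (b * d ^ (p - 2)) * kloosterman k d)"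
    unfolding kloosterman_altdef sum_distrib_left
    by (intro sum.cong refl) (simp add: cong_sym_eq)
  finally show ?thesis .
qed

lemma kloosterman_1:
  assumes "\<not> int p dvd b"
  shows "kloosterman 1 b = chi b"
proof -
  have k0: "kloosterman 0 d = (if [d = 1] (mod int p) then 1 else 0)" for d
    by (simp add: kloosterman_altdef cong_sym_eq)
  have "kloosterman (Suc 0) b = (\<Sum>d\<in>units_p. if [d = 1] (mod int p) then chi (b * d ^ (p - 2)) else 0)"
    unfolding kloosterman_Suc[OF assms] k0 by (intro sum.cong refl) simp
  also have "\<dots> = chi (b * 1 ^ (p - 2))"
    using p_gt_1 by (intro sum_units_delta chi_cong cong_mult cong_pow cong_refl) auto
  finally show ?thesis by simp
qed

text \<open>Inversion and multiplication by \<open>b\<close> both permute the units. In the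
  expansion below this keeps the contribution of the constant \<open>A\<close> free of
  \<open>b\<close>.\<close>

lemma sum_chi_inverse:
  assumes "\<not> int p dvd b"
  shows "(\<Sum>d\<in>units_p. chi (b * d ^ (p - 2))) = (\<Sum>d\<in>units_p. chi d)"
proof -
  have "(\<Sum>d\<in>units_p. chi (b * d ^ (p - 2))) =
    (\<Sum>d\<in>units_p. (\<lambda>c. chi (b * c mod int p)) (d ^ (p - 2) mod int p))"
    by (intro sum.cong refl, simp, rule chi_cong) (simp add: cong_def mod_simps)
  also have "\<dots> = (\<Sum>c\<in>units_p. chi (b * c mod int p))"
    by (rule sum.reindex_bij_betw[OF bij_betw_inverse])
  also have "\<dots> = (\<Sum>d\<in>units_p. chi d)"
    by (rule sum.reindex_bij_betw[OF bij_betw_mult[OF assms]])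
  finally show ?thesis .
qed

text \<open>
  Only the term linear in \<open>b\<close> gains a factor \<open>w - 1\<close> when passing from \<open>k\<close> to \<open>k + 1\<close>:
  modulo \<open>w - 1\<close> the character is trivial, so every error term becomes constant in \<open>b\<close> up to
  one further factor \<open>w - 1\<close>.
\<close>
lemma kloosterman_expansion:
  assumes "odd p"
  shows "\<exists>A\<in>int_ring_adjoin. \<forall>b\<in>units_p. \<exists>r\<in>int_ring_adjoin.
    kloosterman (Suc k) b = A + (- 1) ^ k * of_int b * (w - 1) ^ Suc k + (w - 1) ^ Suc (Suc k) * r"
proof (induction k)
  case 0
  show ?case
  proof (rule bexI[of _ 1], rule ballI)
    fix b assume "b \<in> units_p"
    then have "kloosterman (Suc 0) b = chi b"
      using kloosterman_1 units_p_not_dvd by simp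
    then show "\<exists>r\<in>int_ring_adjoin. kloosterman (Suc 0) b =
      1 + (- 1) ^ 0 * of_int b * (w - 1) ^ Suc 0 + (w - 1) ^ Suc (Suc 0) * r"
      using chi_expansion[OF assms, of b] by (simp add: power2_eq_square)
  qed simp
next
  case (Suc k)
  define \<pi> where "\<pi> = w - 1"
  define s :: complex where "s = (- 1) ^ k"
  obtain A h where A: "A \<in> int_ring_adjoin"
    and h: "\<And>d. d \<in> units_p \<Longrightarrow> h d \<in> int_ring_adjoin"
      "\<And>d. d \<in> units_p \<Longrightarrow>
        kloosterman (Suc k) d = A + s * of_int d * \<pi> ^ Suc k + \<pi> ^ Suc (Suc k) * h d"
    using Suc unfolding \<pi>_def[symmetric] s_def[symmetric] by metis
  obtain c where c: "c \<in> int_ring_adjoin" "of_nat p = \<pi>\<^sup>2 * c"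
    using p_multiple_of_uniformizer_square[OF assms] unfolding \<pi>_def by blast
  obtain r where r: "\<And>a. r a \<in> int_ring_adjoin" "\<And>a. chi a = 1 + of_int a * \<pi> + \<pi>\<^sup>2 * r a"
    using chi_expansion[OF assms] unfolding \<pi>_def by metis
  \<comment> \<open>The Fermat quotient of \<open>d\<close>. It makes the product of
    \<open>d\<close> and its reciprocal equal to 1 plus \<open>int p * q d\<close> exactly, and that
    deviation is a multiple of \<open>\<pi>\<^sup>2\<close>.\<close>
  define q where "q d = (d ^ (p - 1) - 1) div int p" for d :: int
  have q: "d * d ^ (p - 2) = 1 + int p * q d" if "d \<in> units_p" for d
  proof -
    have "d * d ^ (p - 2) = d ^ (p - 1)"
      using p_gt_1 by (simp flip: power_Suc add: Suc_diff_Suc numeral_2_eq_2)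
    moreover have "int p dvd d ^ (p - 1) - 1"
      using fermat_int[OF units_p_not_dvd[OF that]] by (simp add: cong_iff_dvd_diff)
    ultimately show ?thesis by (simp add: q_def)
  qed
  \<comment> \<open>\<open>B\<close> collects everything free of \<open>b\<close>: \<open>A\<close>
    times a permuted character sum, and the other two terms with the character replaced by its
    leading value 1. \<open>R\<close> collects the remainders, with \<open>p\<close> written as
    \<open>\<pi>\<^sup>2 * c\<close>.\<close>
  define B where "B = A * (\<Sum>d\<in>units_p. chi d) + s * \<pi> ^ Suc k * (\<Sum>d\<in>units_p. of_int d)
    + \<pi> ^ Suc (Suc k) * (\<Sum>d\<in>units_p. h d)"
  define R where "R b = s * of_int b * \<pi> * c * (1 + (\<Sum>d\<in>units_p. of_int (q d)))
      + s * (\<Sum>d\<in>units_p. of_int d * r (b * d ^ (p - 2)))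
      + (\<Sum>d\<in>units_p. h d * (of_int (b * d ^ (p - 2)) + \<pi> * r (b * d ^ (p - 2))))" for b
  have \<pi>: "\<pi> \<in> int_ring_adjoin" and s: "s \<in> int_ring_adjoin"
    by (auto simp: \<pi>_def s_def intro!: adjoin_power adjoin_uminus)
  show ?case
    unfolding \<pi>_def[symmetric]
  proof (rule bexI[of _ B], rule ballI)
    show "B \<in> int_ring_adjoin"
      unfolding B_def using A h \<pi> s by (intro adjoin_add adjoin_mult adjoin_sum adjoin_power) auto
    fix b assume b: "b \<in> units_p"
    let ?c = "\<lambda>d. chi (b * d ^ (p - 2))"
    let ?r = "\<lambda>d. r (b * d ^ (p - 2))"
    have "kloosterman (Suc (Suc k)) b = (\<Sum>d\<in>units_p. ?c d * kloosterman (Suc k) d)"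
      by (rule kloosterman_Suc[OF units_p_not_dvd[OF b]])
    also have "\<dots> = (\<Sum>d\<in>units_p. A * ?c d + s * \<pi> ^ Suc k * (of_int d * ?c d)
        + \<pi> ^ Suc (Suc k) * (h d * ?c d))"
      by (intro sum.cong refl) (simp add: h(2) algebra_simps)
    also have "\<dots> = A * (\<Sum>d\<in>units_p. ?c d) + s * \<pi> ^ Suc k * (\<Sum>d\<in>units_p. of_int d * ?c d)
        + \<pi> ^ Suc (Suc k) * (\<Sum>d\<in>units_p. h d * ?c d)"
      by (simp only: sum.distrib sum_distrib_left)
    also have "(\<Sum>d\<in>units_p. ?c d) = (\<Sum>d\<in>units_p. chi d)"
      by (rule sum_chi_inverse[OF units_p_not_dvd[OF b]])
    also have "(\<Sum>d\<in>units_p. of_int d * ?c d) = (\<Sum>d\<in>units_p. of_int d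
        + of_int b * \<pi> * (1 + of_nat p * of_int (q d)) + \<pi>\<^sup>2 * (of_int d * ?r d))"
    proof (intro sum.cong refl)
      fix d assume d: "d \<in> units_p"
      have "(of_int d * of_int (b * d ^ (p - 2)) :: complex) = of_int b * of_int (d * d ^ (p - 2))"
        by simp
      also have "\<dots> = of_int b * (1 + of_nat p * of_int (q d))"
        unfolding q[OF d] by simp
      finally show "of_int d * ?c d = of_int d
        + of_int b * \<pi> * (1 + of_nat p * of_int (q d)) + \<pi>\<^sup>2 * (of_int d * ?r d)"
        unfolding r(2)[of "b * d ^ (p - 2)"] by (simp add: distrib_left mult.assoc[symmetric])
          (simp add: algebra_simps)
    qed
    \<comment> \<open>Each of the \<open>p - 1\<close> units contributes \<open>b\<close> to the
      linear term. As \<open>p\<close> is a multiple of \<open>\<pi>\<^sup>2\<close>, the factor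
      \<open>p - 1\<close> acts as -1 and flips the sign \<open>s\<close>.\<close>
    also have "\<dots> = (\<Sum>d\<in>units_p. of_int d) + of_int b * \<pi> * (of_nat p - 1 +
        of_nat p * (\<Sum>d\<in>units_p. of_int (q d))) + \<pi>\<^sup>2 * (\<Sum>d\<in>units_p. of_int d * ?r d)"
      using p_gt_1 by (simp add: sum.distrib sum_distrib_left[symmetric] of_nat_diff nat_diff_distrib)
    also have "(\<Sum>d\<in>units_p. h d * ?c d) = (\<Sum>d\<in>units_p. h d
        + \<pi> * (h d * (of_int (b * d ^ (p - 2)) + \<pi> * ?r d)))"
      by (intro sum.cong refl) (simp add: r(2)[of "b * _"] algebra_simps power2_eq_square)
    also have "\<dots> = (\<Sum>d\<in>units_p. h d)
        + \<pi> * (\<Sum>d\<in>units_p. h d * (of_int (b * d ^ (p - 2)) + \<pi> * ?r d))"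
      by (simp only: sum.distrib sum_distrib_left)
    finally have "kloosterman (Suc (Suc k)) b =
      B + (- 1) ^ Suc k * of_int b * \<pi> ^ Suc (Suc k) + \<pi> ^ Suc (Suc (Suc k)) * R b"
      unfolding B_def R_def c(2) s_def by (simp add: algebra_simps power2_eq_square)
    moreover have "R b \<in> int_ring_adjoin"
      unfolding R_def using h \<pi> s c r
      by (intro adjoin_add adjoin_mult adjoin_sum adjoin_power) auto
    ultimately show "\<exists>r\<in>int_ring_adjoin. kloosterman (Suc (Suc k)) b =
      B + (- 1) ^ Suc k * of_int b * \<pi> ^ Suc (Suc k) + \<pi> ^ Suc (Suc (Suc k)) * r"
      by blast
  qed
qed

lemma kloosterman_inj:
  assumes "k \<ge> 1" "\<not> int p dvd a" "\<not> int p dvd b" "kloosterman k a = kloosterman k b"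
  shows "[a = b] (mod int p)"
proof (cases "p = 2")
  case True
  then show ?thesis using assms(2,3) by (simp add: cong_def odd_iff_mod_2_eq_one)
next
  case False
  then have odd: "odd p"
    using prime_p p_gt_1 prime_odd_nat by auto
  obtain m where k: "k = Suc m" using assms(1) by (cases k) auto
  define a' b' where "a' = a mod int p" and "b' = b mod int p"
  have a'b': "a' \<in> units_p" "b' \<in> units_p"
    unfolding a'_def b'_def using assms(2,3) by (intro mod_in_units_p; simp)+
  have "kloosterman k a' = kloosterman k a" "kloosterman k b' = kloosterman k b"
    unfolding a'_def b'_def by (intro kloosterman_cong; simp)+
  then have eq: "kloosterman k a' = kloosterman k b'" using assms(4) by simp
  obtain A ra rb where r: "ra \<in> int_ring_adjoin" "rb \<in> int_ring_adjoin"
    "kloosterman k a' = A + (- 1) ^ m * of_int a' * (w - 1) ^ k + (w - 1) ^ Suc k * ra"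
    "kloosterman k b' = A + (- 1) ^ m * of_int b' * (w - 1) ^ k + (w - 1) ^ Suc k * rb"
    using kloosterman_expansion[OF odd, of m] a'b' unfolding k by blast
  have "(w - 1) ^ k * ((- 1) ^ m * of_int (a' - b')) = (w - 1) ^ k * ((w - 1) * (rb - ra))"
    using eq r(3,4) by (simp add: algebra_simps)
  then have "(- 1) ^ m * of_int (a' - b') = (w - 1) * (rb - ra)"
    using w_neq_1 by simp
  then have "of_int ((- 1) ^ m * (a' - b')) = (w - 1) * (rb - ra)"
    by simp
  then have "int p dvd (- 1) ^ m * (a' - b')"
    by (rule p_dvd_if_multiple_of_uniformizer) (intro adjoin_diff r)
  then have "int p dvd a' - b'"
    by (cases "even m") (simp_all add: dvd_diff_commute)
  then have "[a' = b'] (mod int p)"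
    by (simp add: cong_iff_dvd_diff)
  then show ?thesis
    by (simp add: a'_def b'_def cong_def)
qed

end

section \<open>Conjugates of inverted Kloosterman sums\<close>

context prime_root_of_unity
begin

section \<open>Scaling tuples by a unit\<close>

definition scale :: "nat \<Rightarrow> int \<Rightarrow> (nat \<Rightarrow> int) \<Rightarrow> nat \<Rightarrow> int"
  where "scale k t x = (\<lambda>i\<in>{1..k}. t * x i mod int p)"

lemma sum_scale: "[(\<Sum>i\<in>{1..k}. scale k t x i) = t * (\<Sum>i\<in>{1..k}. x i)] (mod int p)"
proof -
  have "[(\<Sum>i\<in>{1..k}. scale k t x i) = (\<Sum>i\<in>{1..k}. t * x i)] (mod int p)"
    by (intro cong_sum) (simp add: scale_def cong_def)
  then show ?thesis by (simp add: sum_distrib_left)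
qed

lemma scale_in_kl_index:
  assumes "\<not> int p dvd t" "x \<in> kl_index k b"
  shows "scale k t x \<in> kl_index k (t ^ k * b)"
proof -
  have x: "x \<in> {1..k} \<rightarrow>\<^sub>E units_p" "[(\<Prod>i\<in>{1..k}. x i) = b] (mod int p)"
    using assms(2) by (simp_all only: kl_index_def mem_Collect_eq)
  have "\<not> int p dvd t * x i" if "i \<in> {1..k}" for i
    using PiE_mem[OF x(1) that] by (intro not_dvd_mult assms(1) units_p_not_dvd)
  then have "scale k t x \<in> {1..k} \<rightarrow>\<^sub>E units_p"
    unfolding scale_def by (intro restrict_PiE_iff[THEN iffD2] ballI mod_in_units_p)
  moreover have "[(\<Prod>i\<in>{1..k}. scale k t x i) = (\<Prod>i\<in>{1..k}. t * x i)] (mod int p)"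
    by (intro cong_prod) (simp add: scale_def cong_def)
  then have "[(\<Prod>i\<in>{1..k}. scale k t x i) = t ^ k * (\<Prod>i\<in>{1..k}. x i)] (mod int p)"
    by (simp add: prod.distrib)
  then have "[(\<Prod>i\<in>{1..k}. scale k t x i) = t ^ k * b] (mod int p)"
    using cong_mult[OF cong_refl[of "t ^ k"] x(2)] cong_trans by blast
  ultimately show ?thesis
    by (simp only: kl_index_def mem_Collect_eq)
qed

lemma kl_index_cong: "[a = b] (mod int p) \<Longrightarrow> kl_index k a = kl_index k b"
  by (simp add: kl_index_def cong_def)

lemma inverse_power_cong:
  "\<not> int p dvd t \<Longrightarrow> [t ^ k * (t ^ (p - 2)) ^ k = 1] (mod int p)"
  using cong_pow[OF inverse_cong, of t k] by (simp add: power_mult_distrib)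

lemma scale_inverse:
  assumes "[u * t = 1] (mod int p)" "x \<in> {1..k} \<rightarrow>\<^sub>E units_p"
  shows "scale k u (scale k t x) = x"
proof
  fix i
  show "scale k u (scale k t x) i = x i"
  proof (cases "i \<in> {1..k}")
    case True
    have xi: "x i \<in> units_p" using PiE_mem[OF assms(2) True] .
    have "[u * t * x i = 1 * x i] (mod int p)"
      using assms(1) by (intro cong_mult cong_refl)
    then have "u * (t * x i mod int p) mod int p = x i"
      using xi by (simp add: cong_def mod_mult_right_eq mult.assoc)
    then show ?thesis using True by (simp add: scale_def)
  next
    case False
    then show ?thesis using PiE_arb[OF assms(2) False] by (simp only: scale_def restrict_def if_False)
  qed
qed

lemma bij_betw_scale:
  assumes t: "\<not> int p dvd t"
  shows "bij_betw (scale k t) (kl_index k b) (kl_index k (t ^ k * b))"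
proof (rule bij_betw_byWitness[where f' = "scale k (t ^ (p - 2))"])
  have inv_t: "[t ^ (p - 2) * t = 1] (mod int p)" "[t * t ^ (p - 2) = 1] (mod int p)"
    using inverse_cong[OF t] by (simp_all add: mult.commute)
  show "\<forall>x\<in>kl_index k b. scale k (t ^ (p - 2)) (scale k t x) = x"
    using scale_inverse[OF inv_t(1)] unfolding kl_index_def by blast
  show "\<forall>x\<in>kl_index k (t ^ k * b). scale k t (scale k (t ^ (p - 2)) x) = x"
    using scale_inverse[OF inv_t(2)] unfolding kl_index_def by blast
  show "scale k t ` kl_index k b \<subseteq> kl_index k (t ^ k * b)"
    using scale_in_kl_index[OF t] by blast
  have "[(t ^ (p - 2)) ^ k * (t ^ k * b) = 1 * b] (mod int p)"
    unfolding mult.assoc[symmetric]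
    using inverse_power_cong[OF t, of k] by (intro cong_mult cong_refl) (simp add: mult.commute)
  then have "kl_index k ((t ^ (p - 2)) ^ k * (t ^ k * b)) = kl_index k b"
    by (intro kl_index_cong) simp
  then show "scale k (t ^ (p - 2)) ` kl_index k (t ^ k * b) \<subseteq> kl_index k b"
    using scale_in_kl_index[OF not_dvd_power[OF t]] by blast
qed

definition ik_index :: "nat \<Rightarrow> int \<Rightarrow> (nat \<Rightarrow> int) set"
  where "ik_index k b = {x \<in> kl_index k b. \<not> int p dvd (\<Sum>i\<in>{1..k}. x i)}"

text \<open>
  The conjugate of the inverted Kloosterman sum (in \<open>k\<close> variables) under \<open>w \<mapsto> w ^ t\<close>;
  inversion modulo \<open>p\<close> is written as the power \<open>p - 2\<close>.
\<close>
definition ik :: "int \<Rightarrow> nat \<Rightarrow> int \<Rightarrow> complex"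
  where "ik t k b = (\<Sum>x\<in>ik_index k b. chi (t * (\<Sum>i\<in>{1..k}. x i) ^ (p - 2)))"

text \<open>This is N(b, s) of the overview.\<close>

definition kl_count :: "nat \<Rightarrow> int \<Rightarrow> int \<Rightarrow> nat"
  where "kl_count k b s = card {x \<in> kl_index k b. [(\<Sum>i\<in>{1..k}. x i) = s] (mod int p)}"

lemma ik_cong: "[a = b] (mod int p) \<Longrightarrow> ik t k a = ik t k b"
  using kl_index_cong[of a b k] by (simp add: ik_def ik_index_def)

lemma kl_count_cong: "[a = b] (mod int p) \<Longrightarrow> kl_count k a s = kl_count k b s"
  using kl_index_cong[of a b k] by (simp add: kl_count_def)

text \<open>Scaling is a bijection of the tuples that multiplies sums by \<open>t\<close>. The value
  s = 0 is fixed, which gives access to the count of zero sums that the inverted sums do not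
  see.\<close>

lemma kl_count_scale:
  assumes "\<not> int p dvd t"
  shows "kl_count k (t ^ k * b) (t * s) = kl_count k b s"
proof -
  have "[(\<Sum>i\<in>{1..k}. scale k t x i) = t * s] (mod int p) \<longleftrightarrow> [(\<Sum>i\<in>{1..k}. x i) = s] (mod int p)" for x
  proof -
    have "[(\<Sum>i\<in>{1..k}. scale k t x i) = t * s] (mod int p) \<longleftrightarrow> [t * (\<Sum>i\<in>{1..k}. x i) = t * s] (mod int p)"
      using sum_scale[of k t x] unfolding cong_def by simp
    also have "\<dots> \<longleftrightarrow> [(\<Sum>i\<in>{1..k}. x i) = s] (mod int p)"
      by (rule mult_cancel_cong[OF assms])
    finally show ?thesis .
  qed
  then have "bij_betw (scale k t) {x \<in> kl_index k b. [(\<Sum>i\<in>{1..k}. x i) = s] (mod int p)}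
    {x \<in> kl_index k (t ^ k * b). [(\<Sum>i\<in>{1..k}. x i) = t * s] (mod int p)}"
    by (rule bij_betw_Collect[OF bij_betw_scale[OF assms]])
  then show ?thesis
    unfolding kl_count_def by (rule bij_betw_same_card[symmetric])
qed

text \<open>Scaling the tuple by \<open>t\<close> divides the reciprocal of its sum by
  \<open>t\<close>, and this cancels the factor \<open>t\<close> in front.\<close>

lemma ik_scale:
  assumes t: "\<not> int p dvd t"
  shows "ik (t * u) k (t ^ k * b) = ik u k b"
proof -
  have "int p dvd (\<Sum>i\<in>{1..k}. scale k t x i) \<longleftrightarrow> int p dvd (\<Sum>i\<in>{1..k}. x i)" for x
    using cong_dvd_iff[OF sum_scale[of k t x]] t prime_int_p by (simp add: prime_dvd_mult_iff)
  then have "bij_betw (scale k t) (ik_index k b) (ik_index k (t ^ k * b))"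
    unfolding ik_index_def by (intro bij_betw_Collect[OF bij_betw_scale[OF t]]) simp
  then have "ik (t * u) k (t ^ k * b) =
    (\<Sum>x\<in>ik_index k b. chi (t * u * (\<Sum>i\<in>{1..k}. scale k t x i) ^ (p - 2)))"
    unfolding ik_def by (rule sum.reindex_bij_betw[symmetric])
  also have "\<dots> = ik u k b"
    unfolding ik_def
  proof (intro sum.cong refl chi_cong)
    fix x :: "nat \<Rightarrow> int"
    let ?s = "\<Sum>i\<in>{1..k}. x i"
    have "[t * u * (\<Sum>i\<in>{1..k}. scale k t x i) ^ (p - 2) = t * u * (t * ?s) ^ (p - 2)] (mod int p)"
      by (intro cong_mult cong_refl cong_pow sum_scale)
    also have "t * u * (t * ?s) ^ (p - 2) = t * t ^ (p - 2) * (u * ?s ^ (p - 2))"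
      by (simp add: power_mult_distrib)
    also have "[\<dots> = 1 * (u * ?s ^ (p - 2))] (mod int p)"
      by (intro cong_mult cong_refl inverse_cong t)
    finally show "[t * u * (\<Sum>i\<in>{1..k}. scale k t x i) ^ (p - 2) = u * ?s ^ (p - 2)] (mod int p)"
      by simp
  qed
  finally show ?thesis .
qed

text \<open>The set \<open>T\<close> of residues is a parameter because ordinary sums also run
  through residue 0, inverted sums only through units.\<close>

lemma sum_by_residue:
  assumes "finite A" "\<And>x. x \<in> A \<Longrightarrow> h x mod int p \<in> T" "T \<subseteq> {0..int p - 1}"
    and f: "\<And>a b. [a = b] (mod int p) \<Longrightarrow> f a = f b"
  shows "(\<Sum>x\<in>A. f (h x)) = (\<Sum>s\<in>T. of_nat (card {x \<in> A. [h x = s] (mod int p)}) * (f s :: complex))"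
proof -
  have "finite T" using assms(3) finite_subset by blast
  then have "(\<Sum>x\<in>A. f (h x)) = (\<Sum>s\<in>T. \<Sum>x\<in>{x \<in> A. h x mod int p = s}. f (h x))"
    using assms(1,2) by (intro sum.group[symmetric]) auto
  also have "\<dots> = (\<Sum>s\<in>T. \<Sum>x\<in>{x \<in> A. [h x = s] (mod int p)}. f s)"
  proof (rule sum.cong[OF refl])
    fix s assume "s \<in> T"
    then have "s mod int p = s" using assms(3) by auto
    then have "{x \<in> A. h x mod int p = s} = {x \<in> A. [h x = s] (mod int p)}"
      by (auto simp: cong_def)
    then show "(\<Sum>x\<in>{x \<in> A. h x mod int p = s}. f (h x)) =
      (\<Sum>x\<in>{x \<in> A. [h x = s] (mod int p)}. f s)"
      using f by (intro sum.cong) auto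
  qed
  finally show ?thesis by simp
qed

lemma kloosterman_eq_sum_count:
  "kloosterman k b = (\<Sum>s\<in>{0..int p - 1}. of_nat (kl_count k b s) * chi s)"
  unfolding kloosterman_def kl_count_def
  using p_gt_1 by (intro sum_by_residue chi_cong) auto

lemma ik_eq_sum_count:
  "ik 1 k b = (\<Sum>s\<in>units_p. of_nat (kl_count k b s) * chi (s ^ (p - 2)))"
proof -
  have "ik 1 k b = (\<Sum>s\<in>units_p. of_nat (card {x \<in> ik_index k b. [(\<Sum>i\<in>{1..k}. x i) = s] (mod int p)}) * chi (s ^ (p - 2)))"
    unfolding ik_def mult_1
    by (rule sum_by_residue) (auto simp: ik_index_def intro!: mod_in_units_p chi_cong cong_pow simp del: atLeastAtMost_iff)
  also have "\<dots> = (\<Sum>s\<in>units_p. of_nat (kl_count k b s) * chi (s ^ (p - 2)))"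
  proof (rule sum.cong[OF refl])
    fix s assume "s \<in> units_p"
    then have "{x \<in> ik_index k b. [(\<Sum>i\<in>{1..k}. x i) = s] (mod int p)} =
      {x \<in> kl_index k b. [(\<Sum>i\<in>{1..k}. x i) = s] (mod int p)}"
      unfolding ik_index_def using units_p_not_dvd cong_dvd_iff by blast
    then show "of_nat (card {x \<in> ik_index k b. [(\<Sum>i\<in>{1..k}. x i) = s] (mod int p)}) * chi (s ^ (p - 2)) =
      of_nat (kl_count k b s) * chi (s ^ (p - 2))"
      by (simp add: kl_count_def)
  qed
  finally show ?thesis .
qed

text \<open>Inversion permutes the units, so this is a relation among w, ..., w^(p-1) with the
  coefficients permuted; \<open>c'\<close> is \<open>c\<close> carried along inversion.\<close>

lemma chi_inverse_independent:
  fixes c :: "int \<Rightarrow> int"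
  assumes "(\<Sum>s\<in>units_p. of_int (c s) * chi (s ^ (p - 2))) = 0" "s \<in> units_p"
  shows "c s = 0"
proof -
  define iv where "iv s = s ^ (p - 2) mod int p" for s :: int
  define c' where "c' j = c (inv_into units_p iv j)" for j
  have bij: "bij_betw iv units_p units_p"
    unfolding iv_def by (rule bij_betw_inverse)
  have c': "c' (iv s) = c s" if "s \<in> units_p" for s
    unfolding c'_def using inv_into_f_f[OF bij_betw_imp_inj_on[OF bij] that] by simp
  have units: "units_p = int ` {1..<p}"
    using image_int_atLeastLessThan[of 1 p] by auto
  have "0 = (\<Sum>s\<in>units_p. of_int (c' (iv s)) * chi (iv s))"
    unfolding assms(1)[symmetric] by (intro sum.cong refl, simp only: c') (simp add: iv_def)
  also have "\<dots> = (\<Sum>j\<in>units_p. of_int (c' j) * chi j)"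
    by (rule sum.reindex_bij_betw[OF bij])
  also have "\<dots> = (\<Sum>j\<in>{1..<p}. of_int (c' (int j)) * w ^ j)"
    unfolding units by (simp add: sum.reindex chi_of_nat)
  finally have "c' (int j) = 0" if "j \<in> {1..<p}" for j
    using w_powers_independent that by simp
  moreover have "iv s \<in> units_p"
    using bij assms(2) by (metis bij_betwE)
  ultimately have "c' (iv s) = 0"
    unfolding units by auto
  then show ?thesis using c'[OF assms(2)] by simp
qed

text \<open>Independence recovers the counts at units only. Assumption \<open>ab\<close>, that the
  parameters differ by a \<open>k\<close>-th power, supplies the remaining count at 0; the claim is
  therefore made among conjugates only.\<close>

lemma ik_inj:
  assumes "k \<ge> 1" "\<not> int p dvd a" "\<not> int p dvd b" "\<not> int p dvd t"
    and ab: "[a = t ^ k * b] (mod int p)" and eq: "ik 1 k a = ik 1 k b"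
  shows "[a = b] (mod int p)"
proof (rule kloosterman_inj[OF assms(1-3)])
  have "(\<Sum>s\<in>units_p. of_int (int (kl_count k a s) - int (kl_count k b s)) * chi (s ^ (p - 2))) = 0"
    using eq unfolding ik_eq_sum_count by (simp add: algebra_simps sum_subtractf)
  then have "int (kl_count k a s) - int (kl_count k b s) = 0" if "s \<in> units_p" for s
    using that by (rule chi_inverse_independent)
  then have units: "kl_count k a s = kl_count k b s" if "s \<in> units_p" for s
    using that by fastforce
  have "kl_count k a 0 = kl_count k b 0"
    using kl_count_cong[OF ab, of k 0] kl_count_scale[OF assms(4), of k b 0] by simp
  then have "kl_count k a s = kl_count k b s" if "s \<in> {0..int p - 1}" for s
    using units that by (cases "s = 0") auto
  then show "kloosterman k a = kloosterman k b"
    unfolding kloosterman_eq_sum_count by (intro sum.cong) simp_all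
qed

lemma ik_eq_ik_1:
  assumes "\<not> int p dvd t"
  shows "ik t k b = ik 1 k ((t ^ (p - 2)) ^ k * b)"
proof -
  have "[t ^ k * ((t ^ (p - 2)) ^ k * b) = 1 * b] (mod int p)"
    unfolding mult.assoc[symmetric]
    by (intro cong_mult cong_refl inverse_power_cong assms)
  then have "ik t k b = ik (t * 1) k (t ^ k * ((t ^ (p - 2)) ^ k * b))"
    by (simp add: ik_cong)
  also have "\<dots> = ik 1 k ((t ^ (p - 2)) ^ k * b)"
    by (rule ik_scale[OF assms])
  finally show ?thesis .
qed

lemma inverse_power_cong_iff:
  assumes "\<not> int p dvd t" "\<not> int p dvd u"
  shows "[(t ^ (p - 2)) ^ k = (u ^ (p - 2)) ^ k] (mod int p) \<longleftrightarrow> [t ^ k = u ^ k] (mod int p)"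
proof -
  let ?t = "(t ^ (p - 2)) ^ k" and ?u = "(u ^ (p - 2)) ^ k"
  have "[u ^ k * (t ^ k * ?t) = u ^ k * 1] (mod int p)" "[t ^ k * (u ^ k * ?u) = t ^ k * 1] (mod int p)"
    by (intro cong_mult cong_refl inverse_power_cong assms)+
  then have 1: "[(u ^ k * t ^ k) * ?t = u ^ k] (mod int p)" "[(u ^ k * t ^ k) * ?u = t ^ k] (mod int p)"
    by (simp_all add: ac_simps)
  have "[?t = ?u] (mod int p) \<longleftrightarrow> [(u ^ k * t ^ k) * ?t = (u ^ k * t ^ k) * ?u] (mod int p)"
    by (intro mult_cancel_cong[symmetric] not_dvd_mult not_dvd_power assms)
  also have "\<dots> \<longleftrightarrow> [u ^ k = t ^ k] (mod int p)"
    using 1 unfolding cong_def by simp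
  finally show ?thesis by (simp add: cong_sym_eq)
qed

lemma ik_eq_iff:
  assumes "k \<ge> 1" and b: "\<not> int p dvd b" and t: "\<not> int p dvd t" and u: "\<not> int p dvd u"
  shows "ik t k b = ik u k b \<longleftrightarrow> [t ^ k = u ^ k] (mod int p)"
proof -
  let ?t = "(t ^ (p - 2)) ^ k" and ?u = "(u ^ (p - 2)) ^ k"
  have "ik t k b = ik u k b \<longleftrightarrow> ik 1 k (?t * b) = ik 1 k (?u * b)"
    by (simp add: ik_eq_ik_1 t u)
  also have "\<dots> \<longleftrightarrow> [?t * b = ?u * b] (mod int p)"
  proof
    \<comment> \<open>The two parameters differ by the \<open>k\<close>-th power of u/t, as
      \<open>ik_inj\<close> demands.\<close>
    have "[?t * b * 1 = ?t * b * (u ^ k * ?u)] (mod int p)"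
      by (intro cong_mult cong_refl cong_sym[OF inverse_power_cong] u)
    then have "[?t * b = (t ^ (p - 2) * u) ^ k * (?u * b)] (mod int p)"
      by (simp add: power_mult_distrib ac_simps)
    moreover have "\<not> int p dvd ?t * b" "\<not> int p dvd ?u * b" "\<not> int p dvd t ^ (p - 2) * u"
      by (intro not_dvd_mult not_dvd_power assms)+
    ultimately show "ik 1 k (?t * b) = ik 1 k (?u * b) \<Longrightarrow> [?t * b = ?u * b] (mod int p)"
      using ik_inj assms(1) by blast
  qed (rule ik_cong)
  also have "\<dots> \<longleftrightarrow> [?t = ?u] (mod int p)"
    unfolding mult.commute[of _ b] by (rule mult_cancel_cong[OF b])
  also have "\<dots> \<longleftrightarrow> [t ^ k = u ^ k] (mod int p)"
    by (rule inverse_power_cong_iff[OF t u])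
  finally show ?thesis .
qed

text \<open>A single \<open>H\<close>, whose exponents are the reciprocals of the sums, serves all
  \<open>t\<close>. This is what makes the \<open>ik (int t) k b\<close> conjugates of one
  another.\<close>

lemma ik_eq_int_poly_eval:
  obtains H where "\<And>t. ik (int t) k b = int_poly_eval H (w ^ t)"
proof
  fix t
  have "chi (int t * m) = (w ^ t) ^ nat (m mod int p)" for m
  proof -
    have "chi (int t * m) = chi (int (t * nat (m mod int p)))"
      using p_gt_1 by (intro chi_cong) (simp add: cong_def mod_simps)
    then show ?thesis by (simp only: chi_of_nat power_mult)
  qed
  then show "ik (int t) k b = int_poly_eval
      (\<Sum>x\<in>ik_index k b. monom 1 (nat ((\<Sum>i\<in>{1..k}. x i) ^ (p - 2) mod int p))) (w ^ t)"
    by (simp add: ik_def)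
qed

end

section \<open>Counting k-th powers modulo p\<close>

lemma card_image_eq_if_same_kernel:
  assumes "\<And>x y. x \<in> A \<Longrightarrow> y \<in> A \<Longrightarrow> f x = f y \<longleftrightarrow> g x = g y"
  shows "card (f ` A) = card (g ` A)"
proof (rule bij_betw_same_card)
  let ?h = "\<lambda>y. g (inv_into A f y)"
  have h: "?h (f x) = g x" if "x \<in> A" for x
    using assms[of "inv_into A f (f x)" x] that by (simp add: inv_into_into f_inv_into_f)
  show "bij_betw ?h (f ` A) (g ` A)"
    using assms h by (intro bij_betw_imageI inj_onI) (auto simp: image_image)
qed

text \<open>The multiples of \<open>k\<close> modulo \<open>m\<close> are the multiples of the gcd
  below \<open>m\<close>, since by Bezout the gcd itself is one of them.\<close>

lemma card_image_mult_mod: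
  assumes "m > (0::nat)"
  shows "card ((\<lambda>i. i * k mod m) ` {..<m}) = m div gcd k m"
proof -
  define d where "d = gcd k m"
  have d: "d > 0" "d dvd k" "d dvd m" using assms by (simp_all add: d_def)
  have "(\<lambda>i. i * k mod m) ` {..<m} = (\<lambda>j. d * j) ` {..<m div d}"
  proof (intro equalityI subsetI)
    fix y assume "y \<in> (\<lambda>i. i * k mod m) ` {..<m}"
    then have "d dvd y" "y < m"
      using d assms by (auto simp: dvd_mod)
    then obtain j where "y = d * j" by (elim dvdE)
    moreover have "j < m div d"
      using \<open>y < m\<close> \<open>y = d * j\<close> d by (metis dvd_mult_div_cancel nat_mult_less_cancel_disj)
    ultimately show "y \<in> (\<lambda>j. d * j) ` {..<m div d}" by blast
  next
    fix y assume "y \<in> (\<lambda>j. d * j) ` {..<m div d}"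
    then obtain j where j: "y = d * j" "j < m div d" by blast
    then have "y < m" using d by (metis dvd_mult_div_cancel nat_mult_less_cancel_disj)
    obtain x where x: "[k * x = d] (mod m)"
    proof (cases "k = 0")
      case True
      then have "[k * 0 = d] (mod m)" by (simp add: d_def cong_def)
      then show ?thesis using that by blast
    qed (use cong_solve_nat[of k m] that in \<open>auto simp: d_def\<close>)
    have "[k * x * j = d * j] (mod m)"
      using x by (intro cong_mult cong_refl)
    then have "(x * j mod m) * k mod m = y"
      using \<open>y < m\<close> j by (simp add: cong_def mod_mult_left_eq mod_mult_right_eq ac_simps)
    then show "y \<in> (\<lambda>i. i * k mod m) ` {..<m}"
      using assms by (intro image_eqI[of _ _ "x * j mod m"]) auto
  qed
  moreover have "inj_on (\<lambda>j. d * j) {..<m div d}"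
    using d by (intro inj_onI) simp
  ultimately show ?thesis
    by (simp add: card_image d_def)
qed

text \<open>Discrete logarithms to a primitive root \<open>g\<close> turn the \<open>k\<close>-th
  power into multiplication by \<open>k\<close> on exponents modulo \<open>p - 1\<close>.\<close>

lemma card_power_residues:
  assumes "prime p"
  shows "card ((\<lambda>t. t ^ k mod p) ` {1..<p}) = (p - 1) div gcd k (p - 1)"
proof -
  have p: "p > 1" using assms by (rule prime_gt_1_nat)
  obtain g where g: "residue_primroot p g"
    using prime_primitive_root_exists[of p] assms p by auto
  have tot: "totient p = p - 1" using assms by (rule totient_prime)
  have bij: "bij_betw (\<lambda>i. g ^ i mod p) {..<p - 1} {1..<p}"
    using residue_primroot_is_generator[OF p g] assms by (simp add: tot totatives_prime atLeastSucLessThan_greaterThanLessThan)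
  have "card ((\<lambda>t. t ^ k mod p) ` {1..<p}) = card ((\<lambda>i. (g ^ i mod p) ^ k mod p) ` {..<p - 1})"
    unfolding bij_betw_imp_surj_on[OF bij, symmetric] image_image ..
  also have "(\<lambda>i. (g ^ i mod p) ^ k mod p) ` {..<p - 1} =
      (\<lambda>i. g ^ i mod p) ` (\<lambda>i. i * k mod (p - 1)) ` {..<p - 1}"
  proof -
    have "(g ^ i mod p) ^ k mod p = g ^ (i * k mod (p - 1)) mod p" for i
    proof -
      have "coprime p g" using g by (simp add: residue_primroot_def)
      moreover have "[i * k = i * k mod (p - 1)] (mod ord p g)"
        using g by (simp add: residue_primroot_def tot cong_def)
      ultimately have "[g ^ (i * k) = g ^ (i * k mod (p - 1))] (mod p)"
        using order_divides_expdiff by blast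
      then show ?thesis by (simp add: cong_def power_mod power_mult)
    qed
    then show ?thesis by (simp add: image_image)
  qed
  also have "card \<dots> = card ((\<lambda>i. i * k mod (p - 1)) ` {..<p - 1})"
    using p by (intro card_image inj_on_subset[OF bij_betw_imp_inj_on[OF bij]]) auto
  also have "\<dots> = (p - 1) div gcd k (p - 1)"
    using p by (intro card_image_mult_mod) simp
  finally show ?thesis .
qed

context prime_root_of_unity
begin

lemma card_conjugates:
  assumes "k \<ge> 1" "\<not> int p dvd b"
  shows "card ((\<lambda>t. ik (int t) k b) ` {1..<p}) = (p - 1) div gcd k (p - 1)"
proof -
  have "card ((\<lambda>t. ik (int t) k b) ` {1..<p}) = card ((\<lambda>t. t ^ k mod p) ` {1..<p})"
  proof (rule card_image_eq_if_same_kernel)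
    fix t u assume "t \<in> {1..<p}" "u \<in> {1..<p}"
    then have "\<not> int p dvd int t" "\<not> int p dvd int u"
      using not_p_dvd by simp_all
    then have "ik (int t) k b = ik (int u) k b \<longleftrightarrow> [int t ^ k = int u ^ k] (mod int p)"
      using assms by (intro ik_eq_iff)
    also have "\<dots> \<longleftrightarrow> [t ^ k = u ^ k] (mod p)"
      by (simp flip: of_nat_power add: cong_int_iff)
    finally show "ik (int t) k b = ik (int u) k b \<longleftrightarrow> t ^ k mod p = u ^ k mod p"
      by (simp add: cong_def)
  qed
  then show ?thesis using card_power_residues[OF prime_p] by simp
qed

end

section \<open>The degree\<close>

text \<open>HOL-Algebra writes polynomials as lists with the leading coefficient first, while
  \<open>Poly\<close> expects the constant one first; hence \<open>rev\<close>.\<close>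

lemma eval_ring_of_type_algebra:
  "ring.eval (ring_of_type_algebra :: complex ring) l x = poly (Poly (rev l)) x"
proof -
  interpret C: field "ring_of_type_algebra :: complex ring" by (rule field_from_type_algebra)
  have pow: "x [^]\<^bsub>ring_of_type_algebra\<^esub> n = x ^ n" for n :: nat
    by (induction n) (simp_all add: ring_of_type_algebra_def nat_pow_def)
  show ?thesis
  proof (induction l)
    case Nil
    show ?case unfolding C.eval.simps by (simp add: ring_of_type_algebra_def)
  next
    case (Cons a l)
    then show ?case
      unfolding C.eval.simps list.sel list.size pow
      by (simp add: Poly_append poly_monom) (simp add: ring_of_type_algebra_def)
  qed
qed

lemma polynomial_rev_coeffs:
  assumes "\<And>i. coeff Q i \<in> \<rat>"
  shows "rev (coeffs Q) \<in> carrier (univ_poly \<C> \<rat>)"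
proof (cases "Q = 0")
  case False
  then have "hd (rev (coeffs Q)) \<noteq> 0"
    using last_coeffs_eq_coeff_degree[of Q] by (simp add: hd_rev)
  moreover have "set (rev (coeffs Q)) \<subseteq> \<rat>"
    using assms by (auto simp: coeffs_def)
  ultimately show ?thesis
    by (auto simp: univ_poly_def polynomial_def ring_of_type_algebra_def)
qed (simp add: univ_poly_def polynomial_def)

text \<open>\<open>Irr\<close> divides the translated \<open>Q\<close>, which bounds its degree from
  above. Translated back, \<open>Irr\<close> is itself a nonzero rational annihilator, so
  \<open>min\<close> gives the other inequality.\<close>

lemma alg_degree_eqI:
  assumes rat: "\<And>i. coeff Q i \<in> \<rat>" and Q: "Q \<noteq> 0" "poly Q \<alpha> = 0"
    and min: "\<And>R. (\<And>i. coeff R i \<in> \<rat>) \<Longrightarrow> R \<noteq> 0 \<Longrightarrow> poly R \<alpha> = 0 \<Longrightarrow> degree Q \<le> degree R"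
  shows "alg_degree \<alpha> = degree Q"
proof -
  interpret C: field \<C> by (rule field_from_type_algebra)
  have z: "\<zero>\<^bsub>\<C>\<^esub> = 0" and carr: "\<alpha> \<in> carrier \<C>"
    by (simp_all add: ring_of_type_algebra_def)
  note sub = subfield_Rats_complex
  define q where "q = rev (coeffs Q)"
  have q: "q \<in> carrier (univ_poly \<C> \<rat>)" "q \<noteq> []" "C.eval q \<alpha> = \<zero>\<^bsub>\<C>\<^esub>"
    unfolding q_def using polynomial_rev_coeffs[OF rat] Q
    by (simp_all add: eval_ring_of_type_algebra z)
  have alg: "(C.algebraic over \<rat>) \<alpha>"
    by (rule C.algebraicI[OF q])
  define l where "l = C.Irr \<rat> \<alpha>"
  have l: "l \<in> carrier (univ_poly \<C> \<rat>)" "hd l = 1" "C.eval l \<alpha> = 0"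
    using C.IrrE[OF sub carr alg] by (simp_all add: l_def z) (simp add: ring_of_type_algebra_def)
  have "l pdivides\<^bsub>\<C>\<^esub> q"
    unfolding l_def by (rule C.Irr_minimal[OF sub carr alg q(1,3)])
  then have "length l - 1 \<le> length q - 1"
    using C.pdivides_imp_degree_le[OF subfieldE(1)[OF sub] l(1) q(1,2)] by simp
  then have le: "length l - 1 \<le> degree Q"
    using Q by (simp add: q_def length_coeffs_degree)
  have "l \<noteq> []"
    using C.IrrE(2)[OF sub carr alg] unfolding l_def
    by (auto dest!: C.pirreducibleE(1)[OF subfieldE(1)[OF sub] C.IrrE(1)[OF sub carr alg]])
  \<comment> \<open>\<open>Poly\<close> strips no entries here, because \<open>l\<close> begins with
    1; so no degree is lost in the translation.\<close>
  define R where "R = Poly (rev l)"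
  have cR: "coeffs R = rev l"
    using l(2) \<open>l \<noteq> []\<close> unfolding R_def coeffs_Poly by (cases l) simp_all
  have "coeff R i \<in> \<rat>" for i
  proof -
    have "set l \<subseteq> \<rat>" using l(1) by (auto simp: univ_poly_def polynomial_def)
    then show ?thesis
      using nth_mem[of i "rev l"] unfolding R_def by (auto simp: nth_default_def coeff_Poly_eq)
  qed
  moreover have "R \<noteq> 0" using cR \<open>l \<noteq> []\<close> by (metis coeffs_0_eq_Nil rev_is_Nil_conv)
  moreover have "poly R \<alpha> = 0" using l(3) by (simp add: R_def eval_ring_of_type_algebra)
  ultimately have "degree Q \<le> degree R" by (rule min)
  also have "degree R = length l - 1"
    using cR by (simp add: degree_eq_length_coeffs)
  finally show ?thesis
    using le unfolding alg_degree_def l_def by simp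
qed

text \<open>Rational annihilators must be made integral before
  \<open>int_poly_eval_conjugate\<close> can carry them to other conjugates; a nonzero factor leaves
  the roots alone.\<close>

lemma clear_denominators:
  assumes "\<And>i. coeff R i \<in> \<rat>"
  shows "\<exists>c f. c \<noteq> 0 \<and> (\<forall>z. of_int c * poly R z = int_poly_eval f z)"
  using assms
proof (induction R)
  case 0
  show ?case by (intro exI[of _ 1] exI[of _ 0]) simp
next
  case (pCons a R)
  have "coeff R i \<in> \<rat>" for i
    using pCons.prems[of "Suc i"] by simp
  with pCons.IH obtain c f where cf: "c \<noteq> 0" "\<And>z. of_int c * poly R z = int_poly_eval f z" by blast
  have "a \<in> \<rat>" using pCons.prems[of 0] by simp
  then obtain m d where "d > 0" "a = of_int m / of_int d"
    by (rule Rats_cases')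
  then have d: "d \<noteq> 0" "a = of_int m / of_int d" by simp_all
  have "of_int (d * c) * poly (pCons a R) z = int_poly_eval (pCons (m * c) (smult d f)) z" for z
    using d by (simp add: cf(2)[symmetric] field_simps)
  then show ?case
    using d(1) cf(1) by (intro exI[of _ "d * c"] exI[of _ "pCons (m * c) (smult d f)"] conjI allI) simp_all
qed

lemma degree_prod_linear: "degree (\<Prod>t\<in>T. [:- f t, 1 :: complex:]) = card T"
  by (subst degree_prod_eq_sum_degree) auto

context prime_root_of_unity
begin

text \<open>The sum over all \<open>p\<close>-th roots of unity is an integer and equals f(1) + (p -
  1) z, which can be solved for \<open>z\<close>.\<close>

lemma rational_if_conjugates_equal:
  assumes "\<And>u. u \<in> {1..<p} \<Longrightarrow> int_poly_eval f (w ^ u) = z"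
  shows "z \<in> \<rat>"
proof -
  obtain m where m: "(\<Sum>u<p. int_poly_eval f (w ^ u)) = of_nat p * of_int m"
    by (rule sum_int_poly_eval)
  have "(\<Sum>u<p. int_poly_eval f (w ^ u)) = of_int (poly f 1) + of_nat (p - 1) * z"
    unfolding lessThan_p by (simp add: assms)
  then have "z = (of_nat p * of_int m - of_int (poly f 1)) / of_nat (p - 1)"
    using m p_gt_1 by (simp add: field_simps)
  also have "\<dots> \<in> \<rat>"
    by (intro Rats_divide Rats_diff Rats_mult Rats_of_nat Rats_of_int)
  finally show ?thesis .
qed

text \<open>The point is that \<open>f\<close> does not depend on \<open>u\<close>: the coefficients
  follow the substitution of \<open>w ^ u\<close> for \<open>w\<close>, so that
  \<open>rational_if_conjugates_equal\<close> can be applied to them.\<close>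

lemma coeff_prod_conjugates:
  assumes "finite T"
  shows "\<exists>f. \<forall>u. coeff (\<Prod>t\<in>T. [:- int_poly_eval H (w ^ (u * t)), 1:]) j = int_poly_eval f (w ^ u)"
  using assms
proof (induction T arbitrary: j)
  case empty
  show ?case by (intro exI[of _ "[:coeff 1 j:]"]) (simp add: coeff_1)
next
  case (insert t T)
  then obtain f where f: "\<And>j u. coeff (\<Prod>t\<in>T. [:- int_poly_eval H (w ^ (u * t)), 1:]) j
      = int_poly_eval (f j) (w ^ u)" by metis
  show ?case
    \<comment> \<open>Multiplying by a linear factor X - h turns coefficient j into coefficient j -
      1 minus h times coefficient j.\<close>
    by (intro exI[of _ "(if j = 0 then 0 else f (j - 1)) - pcompose H (monom 1 t) * f j"])
       (cases j; simp add: insert.hyps f flip: power_mult)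
qed

text \<open>\<open>Q\<close>, the product over the distinct conjugates, is fixed by each
  substitution of \<open>w ^ u\<close> for \<open>w\<close>, hence rational; any rational
  annihilator has all conjugates as roots, so its degree is no smaller.\<close>

lemma alg_degree_int_poly_eval:
  "alg_degree (int_poly_eval H w) = card ((\<lambda>t. int_poly_eval H (w ^ t)) ` {1..<p})"
proof -
  define h where "h t = int_poly_eval H (w ^ t)" for t
  define C where "C = h ` {1..<p}"
  \<comment> \<open>One exponent is chosen per conjugate: \<open>coeff_prod_conjugates\<close> works
    with exponents, but each conjugate may occur only once in \<open>Q\<close>.\<close>
  obtain T where T: "T \<subseteq> {1..<p}" "inj_on h T" "C = h ` T"
    unfolding C_def by (metis order_refl subset_image_inj)
  have "finite T" using T(1) finite_subset by blast
  define Q where "Q = (\<Prod>z\<in>C. [:- z, 1:])"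
  have h_mod: "h (i mod p) = h i" for i
    unfolding h_def by (subst w_pow_cong[of "i mod p" i]) (simp_all add: cong_def)
  have prod: "(\<Prod>t\<in>T. [:- h (u * t), 1:]) = Q" if u: "u \<in> {1..<p}" for u
  proof -
    interpret wu: prime_root_of_unity p "w ^ u"
      by (intro w_power not_p_dvd u)
    obtain v where v: "v \<in> {1..<p}" "[v * u = 1] (mod p)"
      using inverse_mod_p not_p_dvd[OF u] by metis
    have "inj_on (\<lambda>t. h (u * t)) T"
    proof (rule inj_onI)
      fix s t assume st: "s \<in> T" "t \<in> T" "h (u * s) = h (u * t)"
      \<comment> \<open>A coincidence of values at \<open>w ^ u\<close> is carried back to
        \<open>w\<close> by the exponent \<open>v\<close> inverse to \<open>u\<close>, where
        \<open>T\<close> excludes it.\<close>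
      let ?f = "pcompose H (monom 1 s) - pcompose H (monom 1 t)"
      have "int_poly_eval ?f (w ^ u) = 0"
        using st(3) by (simp add: h_def power_mult)
      then have "int_poly_eval ?f ((w ^ u) ^ v) = 0"
        by (rule wu.int_poly_eval_conjugate) (rule not_p_dvd[OF v(1)])
      moreover have "(w ^ u) ^ v = w"
        using w_pow_cong[OF v(2)] by (simp add: mult.commute flip: power_mult)
      ultimately have "h s = h t" by (simp add: h_def)
      then show "s = t" using T(2) st(1,2) by (simp add: inj_on_def)
    qed
    moreover from this have "(\<lambda>t. h (u * t)) ` T = C"
    proof (intro card_subset_eq)
      show "finite C" by (simp add: C_def)
      show "(\<lambda>t. h (u * t)) ` T \<subseteq> C"
      proof (rule image_subsetI)
        fix t assume "t \<in> T"
        then have "\<not> p dvd u * t"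
          using T(1) u not_p_dvd prime_p by (auto simp: prime_dvd_mult_iff)
        then have "u * t mod p \<in> {1..<p}"
          using p_gt_1 by (auto simp: dvd_eq_mod_eq_0)
        then show "h (u * t) \<in> C"
          unfolding C_def by (subst h_mod[symmetric]) (rule imageI)
      qed
      show "card ((\<lambda>t. h (u * t)) ` T) = card C"
        using \<open>inj_on (\<lambda>t. h (u * t)) T\<close> T(2,3) by (simp add: card_image)
    qed
    ultimately show ?thesis
      unfolding Q_def by (metis (no_types, lifting) prod.reindex_cong)
  qed
  have degQ: "degree Q = card C"
    unfolding Q_def by (rule degree_prod_linear)
  have "alg_degree (int_poly_eval H w) = degree Q"
  proof (rule alg_degree_eqI)
    show "coeff Q i \<in> \<rat>" for i
    proof -
      obtain f where f: "\<And>u. coeff (\<Prod>t\<in>T. [:- h (u * t), 1:]) i = int_poly_eval f (w ^ u)"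
        using coeff_prod_conjugates[OF \<open>finite T\<close>, of H i] unfolding h_def by blast
      show ?thesis
        by (rule rational_if_conjugates_equal[of f]) (simp add: f[symmetric] prod)
    qed
    show "Q \<noteq> 0" unfolding Q_def by (simp add: C_def)
    have "int_poly_eval H w \<in> C"
      unfolding C_def using p_gt_1 by (intro image_eqI[of _ _ 1]) (auto simp: h_def)
    then show "poly Q (int_poly_eval H w) = 0"
      unfolding Q_def poly_prod by (intro prod_zero) (auto simp: C_def)
    fix R assume R: "\<And>i. coeff R i \<in> \<rat>" "R \<noteq> 0" "poly R (int_poly_eval H w) = 0"
    obtain c f where cf: "c \<noteq> 0" "\<And>z. of_int c * poly R z = int_poly_eval f z"
      using clear_denominators[OF R(1)] by blast
    have "int_poly_eval (pcompose f H) w = 0"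
      using R(3) by (simp flip: cf(2))
    then have "int_poly_eval (pcompose f H) (w ^ t) = 0" if "t \<in> {1..<p}" for t
      using that by (intro int_poly_eval_conjugate not_p_dvd)
    then have "poly R (h t) = 0" if "t \<in> {1..<p}" for t
      using that cf(1) cf(2)[of "h t"] by (simp add: h_def)
    then have "C \<subseteq> {z. poly R z = 0}"
      unfolding C_def by blast
    then have "card C \<le> card {z. poly R z = 0}"
      using poly_roots_finite[OF R(2)] by (intro card_mono)
    also have "\<dots> \<le> degree R"
      using R(2) by (rule card_poly_roots_bound)
    finally show "degree Q \<le> degree R" unfolding degQ .
  qed
  then show ?thesis by (simp add: degQ C_def h_def)
qed

text \<open>Passage from the operations of the residue ring to integer sums, products and
  congruences; the ring inverse becomes the power \<open>p - 2\<close>, and \<open>n\<close> becomes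
  \<open>n + 1\<close> variables.\<close>

lemma IK_eq_ik:
  assumes b: "b \<in> GFp_star p"
  shows "IK w n p b = ik 1 (n + 1) b"
proof -
  interpret GF: residues_prime p "residue_ring (int p)"
    using prime_p by unfold_locales
  have star: "GFp_star p = units_p"
    unfolding GF.res_carrier_eq GF.res_zero_eq by auto
  have b_mod: "b mod int p = b"
    using b unfolding star by simp
  have prod: "(\<Otimes>\<^bsub>GFp p\<^esub>i\<in>{1..n+1}. x i) = (\<Prod>i\<in>{1..n+1}. x i) mod int p"
    and sum: "(\<Oplus>\<^bsub>GFp p\<^esub>i\<in>{1..n+1}. x i) = (\<Sum>i\<in>{1..n+1}. x i) mod int p"
    if x: "x \<in> {1..n+1} \<rightarrow>\<^sub>E units_p" for x :: "nat \<Rightarrow> int"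
  proof -
    have xi: "x i mod int p = x i" "x i \<in> carrier (GFp p)" if "i \<in> {1..n+1}" for i
      using PiE_mem[OF x that] unfolding GF.res_carrier_eq by simp_all
    have "(\<Otimes>\<^bsub>GFp p\<^esub>i\<in>{1..n+1}. x i) = (\<Otimes>\<^bsub>GFp p\<^esub>i\<in>{1..n+1}. x i mod int p)"
      using xi by (intro GF.finprod_cong') auto
    then show "(\<Otimes>\<^bsub>GFp p\<^esub>i\<in>{1..n+1}. x i) = (\<Prod>i\<in>{1..n+1}. x i) mod int p"
      by (simp only: GF.prod_cong finite_atLeastAtMost)
    have "(\<Oplus>\<^bsub>GFp p\<^esub>i\<in>{1..n+1}. x i) = (\<Oplus>\<^bsub>GFp p\<^esub>i\<in>{1..n+1}. x i mod int p)"
      using xi by (intro GF.add.finprod_cong') auto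
    then show "(\<Oplus>\<^bsub>GFp p\<^esub>i\<in>{1..n+1}. x i) = (\<Sum>i\<in>{1..n+1}. x i) mod int p"
      by (simp only: GF.sum_cong finite_atLeastAtMost)
  qed
  have index: "IK_index n p b = ik_index (n + 1) b"
    unfolding IK_index_def ik_index_def kl_index_def star
  proof (rule Set.set_eqI)
    fix x
    show "x \<in> {x \<in> {1..n+1} \<rightarrow>\<^sub>E units_p. (\<Otimes>\<^bsub>GFp p\<^esub>i\<in>{1..n+1}. x i) = b \<and>
        (\<Oplus>\<^bsub>GFp p\<^esub>i\<in>{1..n+1}. x i) \<noteq> \<zero>\<^bsub>GFp p\<^esub>} \<longleftrightarrow>
      x \<in> {x \<in> {x \<in> {1..n+1} \<rightarrow>\<^sub>E units_p. [(\<Prod>i\<in>{1..n+1}. x i) = b] (mod int p)}.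
        \<not> int p dvd (\<Sum>i\<in>{1..n+1}. x i)}"
    proof (cases "x \<in> {1..n+1} \<rightarrow>\<^sub>E units_p")
      case True
      show ?thesis
        unfolding mem_Collect_eq prod[OF True] sum[OF True] GF.res_zero_eq cong_def b_mod dvd_eq_mod_eq_0
        by (simp only: conj_assoc)
    qed (simp only: mem_Collect_eq simp_thms)
  qed
  have inv: "inv\<^bsub>GFp p\<^esub> (s mod int p) = s ^ (p - 2) mod int p" if "\<not> int p dvd s" for s
  proof (rule GF.comm_inv_char)
    show "s mod int p \<in> carrier (GFp p)" "s ^ (p - 2) mod int p \<in> carrier (GFp p)"
      by simp_all
    show "s mod int p \<otimes>\<^bsub>GFp p\<^esub> (s ^ (p - 2) mod int p) = \<one>\<^bsub>GFp p\<^esub>"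
      using inverse_cong[OF that] p_gt_1
      by (simp add: GF.mult_cong GF.res_one_eq cong_def)
  qed
  \<comment> \<open>Least residues are nonnegative, so the integer power in \<open>add_char\<close>
    is an ordinary one.\<close>
  have chi: "add_char w (m mod int p) = chi m" for m
    using p_gt_1 by (simp add: add_char_def chi_def power_int_def)
  show ?thesis
    unfolding IK_def ik_def index mult_1
  proof (rule sum.cong[OF refl])
    fix x assume "x \<in> ik_index (n + 1) b"
    then have "x \<in> {1..n+1} \<rightarrow>\<^sub>E units_p" "\<not> int p dvd (\<Sum>i\<in>{1..n+1}. x i)"
      unfolding ik_index_def kl_index_def by blast+
    then show "add_char w (inv\<^bsub>GFp p\<^esub> (\<Oplus>\<^bsub>GFp p\<^esub>i\<in>{1..n+1}. x i)) =
      chi ((\<Sum>i\<in>{1..n+1}. x i) ^ (p - 2))"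
      by (simp only: sum inv chi not_False_eq_True)
  qed
qed

end

theorem theorem1p2:
  fixes p n :: nat and b :: int and \<zeta> :: complex
  assumes "Factorial_Ring.prime p"
    and "n \<ge> 1"
    and "b \<in> GFp_star p"
    and "primitive_root_of_unity p \<zeta>"
  shows "alg_degree (IK \<zeta> n p b) = (p - 1) div gcd (n + 1) (p - 1)"
proof -
  interpret prime_root_of_unity p \<zeta>
  proof
    show "\<zeta> ^ p = 1"
      using assms(4) by (simp add: primitive_root_of_unity_def)
    have "1 \<in> {0<..<p}"
      using prime_gt_1_nat[OF assms(1)] by simp
    then show "\<zeta> \<noteq> 1"
      using assms(4) unfolding primitive_root_of_unity_def by fastforce
  qed (fact assms(1))
  have b: "\<not> int p dvd b"
    using assms(3) by (intro units_p_not_dvd) (auto simp: residue_ring_def)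
  obtain H where H: "\<And>t. ik (int t) (n + 1) b = int_poly_eval H (\<zeta> ^ t)"
    using ik_eq_int_poly_eval[of "n + 1" b] by blast
  have "IK \<zeta> n p b = int_poly_eval H \<zeta>"
    using IK_eq_ik[OF assms(3), of n] H[of 1] by simp
  then have "alg_degree (IK \<zeta> n p b) = card ((\<lambda>t. ik (int t) (n + 1) b) ` {1..<p})"
    by (simp only: alg_degree_int_poly_eval H)
  also have "\<dots> = (p - 1) div gcd (n + 1) (p - 1)"
    using card_conjugates[of "n + 1" b] b by simp
  finally show ?thesis .
qed

end
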